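(* Suppose $H(t)^*=H(t)$ for a.e. $t\in(0,d)$. Then: (a) If $\det J\neq0$, then $H,W\in M_n(L^1_{loc}(\mathbb{R}))$ if and only if the local index-1 hypotheses are true for $H-z_0W,\ W$ with respect to $J$ on the interval $\mathbb{R}$ for some $z_0\in\mathbb{C}\setminus\mathbb{R}$ (in which case this is true for every $z_0\in\mathbb{C}$). (b) If $\det J=0$ and $z_0\in\mathbb{C}\setminus\mathbb{R}$, then the local index-1 hypotheses are true for $H-z_0W,\ W$ with respect to $J$ on the interval $\mathbb{R}$ if and only if $$W_{11}\in M_{n_1}(L^1_{loc}(\mathbb{R}))\quad\text{and}\quad H_{11}-H_{12}(H_{22}-z_0W_{22})^{-1}H_{21}\in M_{n_1}(L^1_{loc}(\mathbb{R})).$$ Moreover, statements (a) and (b) remain true if, in the displayed conditions of (a) ($H,W\in M_n(L^1_{loc}(\mathbb{R}))$) and of (b), $L^1_{loc}(\mathbb{R})$ is replaced by $L^1([0,d])$.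
   Context: Notation. For an interval $I\subseteq\mathbb{R}$, $\mathcal{M}(I)$ is the complex vector space of Lebesgue measurable functions $I\to\mathbb{C}$ (a.e. equal functions identified). $L^p_{loc}(I)$ is the set of $f\in\mathcal{M}(I)$ with $f\in L^p([\alpha,\beta])$ for every compact interval $[\alpha,\beta]\subseteq I$. $M_{m\times k}(\mathcal{V})$ denotes $m\times k$ matrices with entries in $\mathcal{V}$, $M_n(\mathcal{V})=M_{n\times n}(\mathcal{V})$; $A^*$ is the (pointwise) conjugate transpose. Standing data. $n\in\mathbb{N}$, $d\in(0,\infty)$; $J\in M_n(\mathbb{C})$ with $J\neq0$, $J^*=-J$; $H,W:\mathbb{R}\to M_n(\mathbb{C})$ have Lebesgue measurable entries and are $d$-periodic: $H(t+d)=H(t)$, $W(t+d)=W(t)$ for all $t$; and $W(t)^*=W(t)\ge0$, $\det W(t)\neq0$ for a.e. $t\in\mathbb{R}$. Block structure when $\det J=0$. Put $n_1=\operatorname{rank}J$, $n_2=\dim\ker J=n-n_1$, and fix a unitary $V\in M_n(\mathbb{C})$ with $V^{-1}JV=\begin{bmatrix}J_{11}&0\\0&0\end{bmatrix}$, $J_{11}\in M_{n_1}(\mathbb{C})$, $\det J_{11}\neq0$ (first $n_1$ columns an orthonormal basis of $\operatorname{ran}J$, the rest of $\ker J$). For a matrix function $A$ write $V^{-1}AV=[A_{ij}]_{i,j=1,2}$ with $A_{ij}$ of size $n_i\times n_j$; in particular this defines $H_{ij}$ and $W_{ij}$. If $A_{22}$ is invertible a.e., the Schur complement is $A/A_{22}=A_{11}-A_{12}A_{22}^{-1}A_{21}$.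 Local index-1 hypotheses. For a measurable $A:I\to M_n(\mathbb{C})$, the local index-1 hypotheses for $A,W$ with respect to $J$ on $I$ are: if $\det J\neq0$, then $A,W\in M_n(L^1_{loc}(I))$; if $\det J=0$, then $A_{22}^{-1}\in M_{n_2}(\mathcal{M}(I))$ (i.e., $A_{22}(t)$ is invertible for a.e. $t$), $A_{12}A_{22}^{-1}W_{22}^{1/2}\in M_{n_1\times n_2}(L^2_{loc}(I))$, $A/A_{22},\,W_{11}\in M_{n_1}(L^1_{loc}(I))$, $W_{22}^{1/2}A_{22}^{-1}W_{22}^{1/2}\in M_{n_2}(L^\infty_{loc}(I))$, $W_{22}^{1/2}(W_{22}^{-1}W_{21}-A_{22}^{-1}A_{21})\in M_{n_2\times n_1}(L^2_{loc}(I))$, and $W/W_{22}\in M_{n_1}(L^1_{loc}(I))$. In the claim, $I=\mathbb{R}$ and $A=H-z_0W$. ($W_{22}^{1/2}$ is the pointwise positive square root.) *)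

theory Defs
  imports
    "HOL-Analysis.Analysis"
    "Jordan_Normal_Form.Schur_Decomposition"
    "Jordan_Normal_Form.Gauss_Jordan_Elimination"
    "Jordan_Normal_Form.DL_Rank"
begin

text \<open>Constants whose base name also exists in the analysis library (such as \<open>det\<close>) are written
  with their qualified name; all matrices are those of \<open>Jordan_Normal_Form\<close>.\<close>

text \<open>The spaces contain functions rather than classes modulo equality almost everywhere; each of
  them is invariant under changes on a null set. Values outside \<open>I\<close> are irrelevant.\<close>

definition Meas :: "real set \<Rightarrow> (real \<Rightarrow> complex) set" where
  "Meas I = borel_measurable (lebesgue_on I)"

definition Lp :: "ennreal \<Rightarrow> real set \<Rightarrow> (real \<Rightarrow> complex) set" where
  "Lp p I = {f \<in> Meas I.
     if p = \<infinity> then (\<exists>C. AE t in lebesgue_on I. norm (f t) \<le> C)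
     else integrable (lebesgue_on I) (\<lambda>t. norm (f t) powr enn2real p)}"

definition Lp_loc :: "ennreal \<Rightarrow> real set \<Rightarrow> (real \<Rightarrow> complex) set" where
  "Lp_loc p I = {f \<in> Meas I. \<forall>\<alpha> \<beta>. {\<alpha>..\<beta>} \<subseteq> I \<longrightarrow> f \<in> Lp p {\<alpha>..\<beta>}}"

definition Mats ::
  "nat \<Rightarrow> nat \<Rightarrow> (real set \<Rightarrow> (real \<Rightarrow> complex) set) \<Rightarrow> real set \<Rightarrow> (real \<Rightarrow> complex mat) set" where
  "Mats m k F I = {A. (\<forall>t\<in>I. A t \<in> carrier_mat m k) \<and>
     (\<forall>i<m. \<forall>j<k. (\<lambda>t. A t $$ (i, j)) \<in> F I)}"

text \<open>\<open>mat_inv\<close> and \<open>psd_sqrt\<close> are totalised by a zero matrix of the same size.\<close>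

definition mat_inv :: "complex mat \<Rightarrow> complex mat" where
  "mat_inv A = (case mat_inverse A of Some B \<Rightarrow> B | None \<Rightarrow> 0\<^sub>m (dim_row A) (dim_row A))"

text \<open>In the order on the complex numbers, \<open>0 \<le> z\<close> says that \<open>z\<close> is real and nonnegative.\<close>

definition psd :: "complex mat \<Rightarrow> bool" where
  "psd A \<longleftrightarrow> square_mat A \<and> mat_adjoint A = A \<and>
     (\<forall>v \<in> carrier_vec (dim_row A). 0 \<le> (A *\<^sub>v v) \<bullet>c v)"

definition psd_sqrt :: "complex mat \<Rightarrow> complex mat" where
  "psd_sqrt A = (if psd A
     then (THE B. B \<in> carrier_mat (dim_row A) (dim_row A) \<and> psd B \<and> B * B = A)
     else 0\<^sub>m (dim_row A) (dim_row A))"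

text \<open>Blocks of \<open>V\<^sup>-\<^sup>1 A V\<close>, where the upper left block has size \<open>r \<times> r\<close>.\<close>

definition blk11 :: "nat \<Rightarrow> complex mat \<Rightarrow> complex mat \<Rightarrow> complex mat" where
  "blk11 r V A = (case split_block (mat_inv V * A * V) r r of (B11, B12, B21, B22) \<Rightarrow> B11)"

definition blk12 :: "nat \<Rightarrow> complex mat \<Rightarrow> complex mat \<Rightarrow> complex mat" where
  "blk12 r V A = (case split_block (mat_inv V * A * V) r r of (B11, B12, B21, B22) \<Rightarrow> B12)"

definition blk21 :: "nat \<Rightarrow> complex mat \<Rightarrow> complex mat \<Rightarrow> complex mat" where
  "blk21 r V A = (case split_block (mat_inv V * A * V) r r of (B11, B12, B21, B22) \<Rightarrow> B21)"

definition blk22 :: "nat \<Rightarrow> complex mat \<Rightarrow> complex mat \<Rightarrow> complex mat" where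
  "blk22 r V A = (case split_block (mat_inv V * A * V) r r of (B11, B12, B21, B22) \<Rightarrow> B22)"

definition schur_compl :: "nat \<Rightarrow> complex mat \<Rightarrow> complex mat \<Rightarrow> complex mat" where
  "schur_compl r V A = blk11 r V A - blk12 r V A * mat_inv (blk22 r V A) * blk21 r V A"

definition adapted_unitary :: "nat \<Rightarrow> complex mat \<Rightarrow> complex mat \<Rightarrow> bool" where
  "adapted_unitary n J V \<longleftrightarrow>
     (let n1 = vec_space.rank n J; n2 = n - n1 in
      V \<in> carrier_mat n n \<and> mat_adjoint V * V = 1\<^sub>m n \<and> V * mat_adjoint V = 1\<^sub>m n \<and>
      (\<exists>J11 \<in> carrier_mat n1 n1. Determinant.det J11 \<noteq> 0 \<and>
         mat_inv V * J * V = four_block_mat J11 (0\<^sub>m n1 n2) (0\<^sub>m n2 n1) (0\<^sub>m n2 n2)))"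

text \<open>\<open>V\<close> is the unitary matrix defining the block structure; it plays no role if \<open>det J \<noteq> 0\<close>.\<close>

definition local_index1 ::
  "nat \<Rightarrow> complex mat \<Rightarrow> complex mat \<Rightarrow> real set \<Rightarrow>
   (real \<Rightarrow> complex mat) \<Rightarrow> (real \<Rightarrow> complex mat) \<Rightarrow> bool" where
  "local_index1 n J V I A W \<longleftrightarrow>
     (if Determinant.det J \<noteq> 0 then A \<in> Mats n n (Lp_loc 1) I \<and> W \<in> Mats n n (Lp_loc 1) I
      else
       let n1 = vec_space.rank n J; n2 = n - n1;
           A12 = (\<lambda>t. blk12 n1 V (A t)); A21 = (\<lambda>t. blk21 n1 V (A t));
           A22 = (\<lambda>t. blk22 n1 V (A t)); A22i = (\<lambda>t. mat_inv (A22 t));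
           W11 = (\<lambda>t. blk11 n1 V (W t)); W21 = (\<lambda>t. blk21 n1 V (W t));
           W22 = (\<lambda>t. blk22 n1 V (W t)); W22i = (\<lambda>t. mat_inv (W22 t));
           S = (\<lambda>t. psd_sqrt (W22 t))
       in (AE t in lebesgue_on I. invertible_mat (A22 t)) \<and>
          A22i \<in> Mats n2 n2 Meas I \<and>
          (\<lambda>t. A12 t * A22i t * S t) \<in> Mats n1 n2 (Lp_loc 2) I \<and>
          (\<lambda>t. schur_compl n1 V (A t)) \<in> Mats n1 n1 (Lp_loc 1) I \<and>
          W11 \<in> Mats n1 n1 (Lp_loc 1) I \<and>
          (\<lambda>t. S t * A22i t * S t) \<in> Mats n2 n2 (Lp_loc \<infinity>) I \<and>
          (\<lambda>t. S t * (W22i t * W21 t - A22i t * A21 t)) \<in> Mats n2 n1 (Lp_loc 2) I \<and>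
          (\<lambda>t. schur_compl n1 V (W t)) \<in> Mats n1 n1 (Lp_loc 1) I)"

end

theory Submission
  imports Defs
begin

text \<open>Write \<open>S = W\<^sub>2\<^sub>2\<^sup>1\<^sup>/\<^sup>2\<close> and \<open>A\<^sub>2\<^sub>2 = H\<^sub>2\<^sub>2 - z W\<^sub>2\<^sub>2\<close>. Everything is expressed through
  \<open>X = S W\<^sub>2\<^sub>2\<^sup>-\<^sup>1 W\<^sub>2\<^sub>1\<close>, \<open>R = S A\<^sub>2\<^sub>2\<^sup>-\<^sup>1 S\<close>, \<open>Y = S A\<^sub>2\<^sub>2\<^sup>-\<^sup>1 H\<^sub>2\<^sub>1\<close>, \<open>Z = H\<^sub>1\<^sub>2 A\<^sub>2\<^sub>2\<^sup>-\<^sup>1 S\<close> and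
  \<open>B = H\<^sub>1\<^sub>1 - H\<^sub>1\<^sub>2 A\<^sub>2\<^sub>2\<^sup>-\<^sup>1 H\<^sub>2\<^sub>1\<close>. Positivity of the Schur complement of \<open>W\<^sub>2\<^sub>2\<close> gives \<open>X\<^sup>* X \<le> W\<^sub>1\<^sub>1\<close>,
  so \<open>X\<close> is locally square integrable when \<open>W\<^sub>1\<^sub>1\<close> is locally integrable. Since \<open>H\<close> is Hermitian,
  the resolvent identity yields \<open>\<bar>R\<bar> \<le> 1 / \<bar>Im z\<bar>\<close> and \<open>\<bar>Im z\<bar> Y\<^sup>* Y = \<bar>Im B\<bar> = \<bar>Im z\<bar> Z Z\<^sup>*\<close>, hence \<open>Y\<close>
  and \<open>Z\<close> are locally square integrable when \<open>B\<close> is locally integrable. All index-1 conditions are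
  obtained from \<open>W\<^sub>1\<^sub>1\<close>, \<open>B\<close>, \<open>Y\<close>, \<open>Z\<close> by adding products of these factors, and conversely.\<close>

section \<open>Matrix algebra\<close>

text \<open>When \<open>J\<close> is singular, the factors
  \<open>A\<^sub>2\<^sub>2\<^sup>-\<^sup>1\<close>, \<open>H\<^sub>2\<^sub>1\<close> and
  \<open>W\<^sub>2\<^sub>1\<close> need not be integrable one by one; only certain products are
  controlled. The weight \<open>S\<close> organises them: inserting \<open>S * S * Wi = 1\<close>
  between two factors turns each mixed term into a product of two locally square integrable factors,
  possibly with the bounded \<open>R\<close> between them. The direction of inference is the
  delicate point. \<open>B\<close> and the Schur complement of the pencil differ by terms containing
  \<open>Y\<close> and \<open>Z\<close>, so their integrability can be compared only once
  \<open>Y\<close> and \<open>Z\<close> are square integrable. Towards \<open>B\<close>, the index-1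
  conditions on the off-diagonal blocks provide this; starting from \<open>B\<close>, the resolvent
  identity does. Matrix inequalities are read on the diagonal, where a Gram matrix shows the squared
  lengths of columns; this yields bounds for all entries without an operator norm. Membership in the
  function spaces includes measurability, which is not evident for \<open>S\<close>. Polynomial
  approximation of the square root with coefficients independent of the matrix settles it.\<close>

lemma dim_mat_adjoint [simp]:
  "dim_row (mat_adjoint A) = dim_col A" "dim_col (mat_adjoint A) = dim_row A"
  by (auto simp: mat_adjoint_def)

lemma index_mat_adjoint [simp]:
  fixes A :: "complex mat"
  assumes "i < dim_col A" "j < dim_row A"
  shows "mat_adjoint A $$ (i, j) = cnj (A $$ (j, i))"
  using assms by (simp add: mat_adjoint_def mat_of_rows_def)

lemma mat_adjoint_carrier [simp]: "A \<in> carrier_mat m k \<Longrightarrow> mat_adjoint A \<in> carrier_mat k m"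
  by (metis carrier_matD carrier_matI dim_mat_adjoint)

lemma index_mult_mat_sum:
  assumes "i < dim_row A" "j < dim_col B" "dim_col A = dim_row B"
  shows "(A * B) $$ (i, j) = (\<Sum>k<dim_row B. A $$ (i, k) * B $$ (k, j))"
  using assms by (auto simp: scalar_prod_def lessThan_atLeast0 intro!: sum.cong)

lemma mat_adjoint_mult:
  fixes A B :: "complex mat"
  assumes "dim_col A = dim_row B"
  shows "mat_adjoint (A * B) = mat_adjoint B * mat_adjoint A"
  by (rule eq_matI)
    (use assms in \<open>auto simp: index_mult_mat_sum mult.commute simp del: index_mult_mat(1)\<close>)

lemma mat_adjoint_diff:
  fixes A B :: "complex mat"
  assumes "dim_row A = dim_row B" "dim_col A = dim_col B"
  shows "mat_adjoint (A - B) = mat_adjoint A - mat_adjoint B"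
  by (rule eq_matI) (use assms in auto)

lemma mat_adjoint_smult: "mat_adjoint (c \<cdot>\<^sub>m A) = cnj c \<cdot>\<^sub>m mat_adjoint A"
  by (rule eq_matI) auto

lemma mat_adjoint_adjoint [simp]: "mat_adjoint (mat_adjoint A) = (A :: complex mat)"
  by (rule eq_matI) auto

lemma mat_adjoint_one [simp]: "mat_adjoint (1\<^sub>m n) = (1\<^sub>m n :: complex mat)"
  by (rule eq_matI) auto

text \<open>Variants of the carrier-based laws whose side conditions the simplifier can discharge.\<close>

lemma mat_mult_assoc:
  fixes A B C :: "'a :: semiring_0 mat"
  assumes "dim_col A = dim_row B" "dim_col B = dim_row C"
  shows "A * B * C = A * (B * C)"
  using assms by (metis assoc_mult_mat carrier_matI)

lemma mat_distrib:
  fixes A B C :: "'a :: ring mat"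
  shows "dim_row A = dim_row B \<Longrightarrow> dim_col A = dim_col B \<Longrightarrow> dim_col B = dim_row C \<Longrightarrow>
      (A + B) * C = A * C + B * C"
    "dim_row A = dim_row B \<Longrightarrow> dim_col A = dim_col B \<Longrightarrow> dim_col B = dim_row C \<Longrightarrow>
      (A - B) * C = A * C - B * C"
    "dim_row B = dim_row C \<Longrightarrow> dim_col B = dim_col C \<Longrightarrow> dim_col A = dim_row C \<Longrightarrow>
      A * (B + C) = A * B + A * C"
    "dim_row B = dim_row C \<Longrightarrow> dim_col B = dim_col C \<Longrightarrow> dim_col A = dim_row C \<Longrightarrow>
      A * (B - C) = A * B - A * C"
  by (metis add_mult_distrib_mat carrier_matI, metis minus_mult_distrib_mat carrier_matI,
      metis mult_add_distrib_mat carrier_matI, metis mult_minus_distrib_mat carrier_matI)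

lemma mat_smult_mult:
  fixes A B :: "'a :: comm_ring_1 mat"
  shows "dim_col A = dim_row B \<Longrightarrow> (c \<cdot>\<^sub>m A) * B = c \<cdot>\<^sub>m (A * B)"
    "dim_col A = dim_row B \<Longrightarrow> A * (c \<cdot>\<^sub>m B) = c \<cdot>\<^sub>m (A * B)"
  by (metis mult_smult_assoc_mat carrier_matI, metis mult_smult_distrib carrier_matI)

lemmas mat_dim_algebra = mat_mult_assoc mat_distrib mat_smult_mult

section \<open>Inverses and their explicit formula\<close>

lemma mat_inv_carrier:
  assumes "A \<in> carrier_mat n n"
  shows "mat_inv A \<in> carrier_mat n n"
  using mat_inverse(2)[OF assms] assms by (auto simp: mat_inv_def split: option.splits)

lemma dim_mat_inv [simp]:
  assumes "dim_row A = dim_col A"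
  shows "dim_row (mat_inv A) = dim_col A" "dim_col (mat_inv A) = dim_col A"
  using carrier_matD[OF mat_inv_carrier[OF carrier_matI[OF assms refl]]] .

lemma mat_inv_mult:
  assumes A: "A \<in> carrier_mat n n" and "Determinant.det A \<noteq> 0"
  shows "A * mat_inv A = 1\<^sub>m n" "mat_inv A * A = 1\<^sub>m n"
proof -
  have "A \<in> Units (ring_mat TYPE(complex) n ())"
    by (rule det_non_zero_imp_unit[OF assms])
  then obtain B where "mat_inverse A = Some B"
    using mat_inverse(1)[OF A, of "()"] by (cases "mat_inverse A") auto
  then show "A * mat_inv A = 1\<^sub>m n" "mat_inv A * A = 1\<^sub>m n"
    using mat_inverse(2)[OF A] by (auto simp: mat_inv_def)
qed

lemma mat_inv_unique:
  assumes A: "A \<in> carrier_mat n n" and B: "B \<in> carrier_mat n n" and AB: "B * A = 1\<^sub>m n"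
  shows "mat_inv A = B"
proof -
  have "Determinant.det B * Determinant.det A = 1"
    using det_mult[OF B A] AB by simp
  then have "Determinant.det A \<noteq> 0"
    by auto
  note inv = mat_inv_mult[OF A this]
  have "mat_inv A = B * A * mat_inv A"
    unfolding AB using mat_inv_carrier[OF A] by simp
  also have "\<dots> = B * (A * mat_inv A)"
    using A B mat_inv_carrier[OF A] by (intro assoc_mult_mat)
  finally show ?thesis
    using inv B by simp
qed

text \<open>Cramer's rule. It exhibits the entries of the inverse as quotients of polynomials in the
  entries of \<open>A\<close>, which later gives their measurability.\<close>

lemma mat_inv_adj_mat:
  assumes A: "A \<in> carrier_mat n n" and "Determinant.det A \<noteq> 0"
  shows "mat_inv A = (1 / Determinant.det A) \<cdot>\<^sub>m adj_mat A"
proof (rule mat_inv_unique[OF A])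
  show "(1 / Determinant.det A) \<cdot>\<^sub>m adj_mat A \<in> carrier_mat n n"
    using adj_mat(1)[OF A] by simp
  show "(1 / Determinant.det A) \<cdot>\<^sub>m adj_mat A * A = 1\<^sub>m n"
    using assms adj_mat[OF A] by (subst mult_smult_assoc_mat) auto
qed

text \<open>An inverse would force the product of two determinants to be 1. Pinning down the value
  in the singular case makes the formula for \<open>mat_inv\<close> global, so that measurability
  holds for the function itself, with no exceptional set.\<close>

lemma mat_inv_singular:
  assumes A: "A \<in> carrier_mat n n" and "Determinant.det A = 0"
  shows "mat_inv A = 0\<^sub>m n n"
proof (cases "mat_inverse A")
  case (Some B)
  then have "A * B = 1\<^sub>m n" "B \<in> carrier_mat n n"
    using mat_inverse(2)[OF A] by auto
  then have "Determinant.det A * Determinant.det B = 1"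
    using det_mult[OF A, of B] by simp
  with assms show ?thesis by simp
qed (simp add: A mat_inv_def carrier_matD[OF A])

lemma mat_adjoint_inv:
  assumes A: "A \<in> carrier_mat n n" and "Determinant.det A \<noteq> 0"
  shows "mat_adjoint (mat_inv A) = mat_inv (mat_adjoint A)"
proof (rule mat_inv_unique[symmetric])
  show "mat_adjoint (mat_inv A) * mat_adjoint A = 1\<^sub>m n"
    using mat_inv_mult[OF assms] A mat_inv_carrier[OF A] by (subst mat_adjoint_mult[symmetric]) auto
qed (simp_all add: A mat_inv_carrier[OF A])

lemma invertible_mat_det:
  assumes A: "A \<in> carrier_mat n n" and "Determinant.det A \<noteq> (0 :: complex)"
  shows "invertible_mat A"
  using mat_inv_mult[OF assms] carrier_matD[OF A] carrier_matD[OF mat_inv_carrier[OF A]]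
  unfolding invertible_mat_def inverts_mat_def square_mat.simps by metis

section \<open>Adjoints and positive semidefinite matrices\<close>

lemma adjoint_cscalar_prod:
  fixes A :: "complex mat"
  assumes A: "A \<in> carrier_mat m k" and v: "v \<in> carrier_vec k" and u: "u \<in> carrier_vec m"
  shows "(A *\<^sub>v v) \<bullet>c u = v \<bullet>c (mat_adjoint A *\<^sub>v u)"
proof -
  have "(A *\<^sub>v v) \<bullet>c u = (\<Sum>i<m. \<Sum>j<k. A $$ (i, j) * v $ j * cnj (u $ i))"
    using assms by (simp add: scalar_prod_def lessThan_atLeast0 sum_distrib_right)
  also have "\<dots> = (\<Sum>j<k. \<Sum>i<m. A $$ (i, j) * v $ j * cnj (u $ i))"
    by (rule sum.swap)
  also have "\<dots> = v \<bullet>c (mat_adjoint A *\<^sub>v u)"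
    using assms by (simp add: scalar_prod_def lessThan_atLeast0 sum_distrib_left mult_ac)
  finally show ?thesis .
qed

lemma psd_congruence:
  assumes A: "A \<in> carrier_mat n n" "psd A" and P: "P \<in> carrier_mat n k"
  shows "psd (mat_adjoint P * A * P)"
proof -
  have *: "mat_adjoint A = A" and pos: "\<And>v. v \<in> carrier_vec n \<Longrightarrow> 0 \<le> (A *\<^sub>v v) \<bullet>c v"
    using A by (auto simp: psd_def)
  have "0 \<le> (mat_adjoint P * A * P *\<^sub>v v) \<bullet>c v" if v: "v \<in> carrier_vec k" for v
  proof -
    have "mat_adjoint P * A * P *\<^sub>v v = (mat_adjoint P * A) *\<^sub>v (P *\<^sub>v v)"
      using A P v by (intro assoc_mult_mat_vec) auto
    also have "\<dots> = mat_adjoint P *\<^sub>v (A *\<^sub>v (P *\<^sub>v v))"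
      using A P v by (intro assoc_mult_mat_vec) auto
    also have "\<dots> \<bullet>c v = (A *\<^sub>v (P *\<^sub>v v)) \<bullet>c (P *\<^sub>v v)"
      using A P v by (subst adjoint_cscalar_prod[of _ k n]) auto
    finally show ?thesis
      using pos P v by auto
  qed
  moreover have "mat_adjoint (mat_adjoint P * A * P) = mat_adjoint P * A * P"
    using A P * by (simp add: mat_adjoint_mult mat_dim_algebra)
  ultimately show ?thesis
    using A P by (simp add: psd_def square_mat.simps)
qed

lemma psd_diag:
  assumes A: "A \<in> carrier_mat n n" "psd A" and i: "i < n"
  shows "0 \<le> A $$ (i, i)"
proof -
  have "0 \<le> (A *\<^sub>v unit_vec n i) \<bullet>c unit_vec n i"
    using A by (auto simp: psd_def)
  also have "A *\<^sub>v unit_vec n i = col A i"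
    using A i by (intro eq_vecI) auto
  also have "conjugate (unit_vec n i) = (unit_vec n i :: complex vec)"
    by (intro eq_vecI) (auto simp: unit_vec_def)
  also have "col A i \<bullet> unit_vec n i = A $$ (i, i)"
    using A i by (subst scalar_prod_right_unit) auto
  finally show ?thesis .
qed

section \<open>Matrices with entries in function spaces\<close>

lemma Meas_UNIV [simp]: "Meas UNIV = borel_measurable lebesgue"
  by (simp add: Meas_def lebesgue_on_UNIV_eq)

lemma Meas_subset: "f \<in> borel_measurable lebesgue \<Longrightarrow> f \<in> Meas S"
  by (simp add: Meas_def measurable_restrict_space1)

lemma Lp_1_iff:
  assumes "f \<in> borel_measurable lebesgue"
  shows "f \<in> Lp 1 S \<longleftrightarrow> integrable (lebesgue_on S) (\<lambda>t. norm (f t))"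
  using Meas_subset[OF assms] by (simp add: Lp_def)

lemma Lp_2_iff:
  assumes "f \<in> borel_measurable lebesgue"
  shows "f \<in> Lp 2 S \<longleftrightarrow> integrable (lebesgue_on S) (\<lambda>t. (norm (f t))\<^sup>2)"
  using Meas_subset[OF assms] by (simp add: Lp_def powr_numeral)

lemma Lp_loc_1_iff:
  "f \<in> Lp_loc 1 UNIV \<longleftrightarrow> f \<in> borel_measurable lebesgue \<and>
     (\<forall>a b. integrable (lebesgue_on {a..b}) (\<lambda>t. norm (f t)))"
  by (auto simp: Lp_loc_def Lp_1_iff)

lemma Lp_loc_2_iff:
  "f \<in> Lp_loc 2 UNIV \<longleftrightarrow> f \<in> borel_measurable lebesgue \<and>
     (\<forall>a b. integrable (lebesgue_on {a..b}) (\<lambda>t. (norm (f t))\<^sup>2))"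
  by (auto simp: Lp_loc_def Lp_2_iff)

lemma Lp_loc_infinity_iff:
  "f \<in> Lp_loc \<infinity> UNIV \<longleftrightarrow> f \<in> borel_measurable lebesgue \<and>
     (\<forall>a b. \<exists>C. AE t in lebesgue_on {a..b}. norm (f t) \<le> C)"
  by (auto simp: Lp_loc_def Lp_def Meas_subset)

lemma AE_lebesgue_on:
  fixes S :: "real set"
  assumes "AE t in lebesgue. P t" "S \<in> sets lebesgue"
  shows "AE t in lebesgue_on S. P t"
  using assms by (subst AE_restrict_space_iff) auto

lemma Lp_loc_1_dominated:
  assumes "f \<in> borel_measurable lebesgue" "g \<in> Lp_loc 1 UNIV"
    "AE t in lebesgue. norm (f t) \<le> norm (g t)"
  shows "f \<in> Lp_loc 1 UNIV"
  unfolding Lp_loc_1_iff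
proof (intro conjI allI)
  fix a b :: real
  show "integrable (lebesgue_on {a..b}) (\<lambda>t. norm (f t))"
  proof (rule Bochner_Integration.integrable_bound)
    show "integrable (lebesgue_on {a..b}) (\<lambda>t. norm (g t))"
      using assms(2) by (simp add: Lp_loc_1_iff)
    show "(\<lambda>t. norm (f t)) \<in> borel_measurable (lebesgue_on {a..b})"
      using assms(1) by (intro measurable_restrict_space1) measurable
    show "AE t in lebesgue_on {a..b}. norm (norm (f t)) \<le> norm (norm (g t))"
      using AE_lebesgue_on[OF assms(3)] by simp
  qed
qed (rule assms)

text \<open>The estimates for \<open>X\<close>, \<open>Y\<close> and \<open>Z\<close> arrive in this
  form: the square of an entry lies below a constant times a diagonal entry of a locally integrable
  matrix.\<close>

lemma Lp_loc_2_dominated: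
  assumes "f \<in> borel_measurable lebesgue" "g \<in> Lp_loc 1 UNIV"
    "AE t in lebesgue. (norm (f t))\<^sup>2 \<le> C * norm (g t)"
  shows "f \<in> Lp_loc 2 UNIV"
  unfolding Lp_loc_2_iff
proof (intro conjI allI)
  fix a b :: real
  show "integrable (lebesgue_on {a..b}) (\<lambda>t. (norm (f t))\<^sup>2)"
  proof (rule Bochner_Integration.integrable_bound)
    show "integrable (lebesgue_on {a..b}) (\<lambda>t. C * norm (g t))"
      using assms(2) by (auto simp: Lp_loc_1_iff)
    show "(\<lambda>t. (norm (f t))\<^sup>2) \<in> borel_measurable (lebesgue_on {a..b})"
      using assms(1) by (intro measurable_restrict_space1) measurable
    have "AE t in lebesgue. norm ((norm (f t))\<^sup>2) \<le> norm (C * norm (g t))"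
      using assms(3) by eventually_elim auto
    then show "AE t in lebesgue_on {a..b}. norm ((norm (f t))\<^sup>2) \<le> norm (C * norm (g t))"
      by (intro AE_lebesgue_on) auto
  qed
qed (rule assms)

text \<open>The closure properties shared by measurable, locally integrable and locally square
  integrable functions, so that matrix operations are treated once for all of them. The last
  conjunct replaces the identification of functions that agree almost everywhere.\<close>

definition ae_space :: "(real \<Rightarrow> complex) set \<Rightarrow> bool" where
  "ae_space F \<longleftrightarrow> (\<lambda>t. 0) \<in> F \<and> (\<forall>f\<in>F. \<forall>g\<in>F. (\<lambda>t. f t + g t) \<in> F) \<and>
     (\<forall>f\<in>F. \<forall>c. (\<lambda>t. c * f t) \<in> F) \<and>
     (\<forall>f\<in>F. \<forall>g. (AE t in lebesgue. f t = g t) \<longrightarrow> g \<in> F)"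

lemma ae_spaceI:
  assumes "(\<lambda>t. 0) \<in> F" "\<And>f g. f \<in> F \<Longrightarrow> g \<in> F \<Longrightarrow> (\<lambda>t. f t + g t) \<in> F"
    "\<And>f c. f \<in> F \<Longrightarrow> (\<lambda>t. c * f t) \<in> F"
    "\<And>f g. f \<in> F \<Longrightarrow> AE t in lebesgue. f t = g t \<Longrightarrow> g \<in> F"
  shows "ae_space F"
  using assms unfolding ae_space_def by blast

lemma ae_spaceD:
  assumes "ae_space F"
  shows "(\<lambda>t. 0) \<in> F" "f \<in> F \<Longrightarrow> g \<in> F \<Longrightarrow> (\<lambda>t. f t + g t) \<in> F"
    "f \<in> F \<Longrightarrow> (\<lambda>t. c * f t) \<in> F"
    "f \<in> F \<Longrightarrow> AE t in lebesgue. f t = g t \<Longrightarrow> g \<in> F"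
  using assms unfolding ae_space_def by blast+

lemma ae_space_sum:
  assumes F: "ae_space F" and "\<And>k. k \<in> K \<Longrightarrow> f k \<in> F"
  shows "(\<lambda>t. \<Sum>k\<in>K. f k t) \<in> F"
  using assms(2) by (induction K rule: infinite_finite_induct) (auto intro: ae_spaceD[OF F])

lemma ae_space_Meas: "ae_space (Meas UNIV)"
  by (auto simp: ae_space_def intro: borel_measurable_AE)

lemma ae_space_Lp_loc_1: "ae_space (Lp_loc 1 UNIV)"
proof (rule ae_spaceI)
  show "(\<lambda>t. f t + g t) \<in> Lp_loc 1 UNIV" if "f \<in> Lp_loc 1 UNIV" "g \<in> Lp_loc 1 UNIV" for f g
  proof -
    have "integrable (lebesgue_on {a..b}) (\<lambda>t. norm (f t + g t))" for a b
    proof (rule Bochner_Integration.integrable_bound)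
      show "integrable (lebesgue_on {a..b}) (\<lambda>t. norm (f t) + norm (g t))"
        using that by (auto simp: Lp_loc_1_iff)
      show "(\<lambda>t. norm (f t + g t)) \<in> borel_measurable (lebesgue_on {a..b})"
        using that by (intro measurable_restrict_space1) (auto simp: Lp_loc_1_iff)
    qed (auto intro!: AE_I2 norm_triangle_ineq)
    then show ?thesis
      using that by (auto simp: Lp_loc_1_iff)
  qed
  show "g \<in> Lp_loc 1 UNIV" if "f \<in> Lp_loc 1 UNIV" "AE t in lebesgue. f t = g t" for f g
  proof (rule Lp_loc_1_dominated[OF _ that(1)])
    show "g \<in> borel_measurable lebesgue"
      using that by (auto simp: Lp_loc_1_iff intro: borel_measurable_AE)
    show "AE t in lebesgue. norm (g t) \<le> norm (f t)"
      using that(2) by eventually_elim simp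
  qed
qed (auto simp: Lp_loc_1_iff norm_mult)

lemma norm_mult_le_squares: "norm (x * y) \<le> (norm x)\<^sup>2 + (norm (y :: complex))\<^sup>2"
proof -
  have "2 * (norm x * norm y) \<le> (norm x)\<^sup>2 + (norm y)\<^sup>2"
    using sum_squares_bound[of "norm x" "norm y"] by simp
  moreover have "0 \<le> norm x * norm y"
    by simp
  ultimately have "norm x * norm y \<le> (norm x)\<^sup>2 + (norm y)\<^sup>2"
    by linarith
  then show ?thesis
    by (simp add: norm_mult)
qed

text \<open>Only integrability matters here, not the size of the integral, so the pointwise bound
  |xy| \<le> |x|^2 + |y|^2 can stand in for the Cauchy-Schwarz inequality.\<close>

lemma Lp_loc_2_mult:
  assumes "f \<in> Lp_loc 2 UNIV" "g \<in> Lp_loc 2 UNIV"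
  shows "(\<lambda>t. f t * g t) \<in> Lp_loc 1 UNIV"
proof -
  have "integrable (lebesgue_on {a..b}) (\<lambda>t. norm (f t * g t))" for a b
  proof (rule Bochner_Integration.integrable_bound)
    show "integrable (lebesgue_on {a..b}) (\<lambda>t. (norm (f t))\<^sup>2 + (norm (g t))\<^sup>2)"
      using assms by (auto simp: Lp_loc_2_iff)
    show "(\<lambda>t. norm (f t * g t)) \<in> borel_measurable (lebesgue_on {a..b})"
      using assms by (intro measurable_restrict_space1) (auto simp: Lp_loc_2_iff)
  qed (use norm_mult_le_squares in \<open>auto intro!: AE_I2\<close>)
  then show ?thesis
    using assms by (auto simp: Lp_loc_1_iff Lp_loc_2_iff)
qed

lemma ae_space_Lp_loc_2: "ae_space (Lp_loc 2 UNIV)"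
proof (rule ae_spaceI)
  show "(\<lambda>t. f t + g t) \<in> Lp_loc 2 UNIV" if "f \<in> Lp_loc 2 UNIV" "g \<in> Lp_loc 2 UNIV" for f g
  proof -
    have "integrable (lebesgue_on {a..b}) (\<lambda>t. (norm (f t + g t))\<^sup>2)" for a b
    proof (rule Bochner_Integration.integrable_bound)
      show "integrable (lebesgue_on {a..b}) (\<lambda>t. 2 * ((norm (f t))\<^sup>2 + (norm (g t))\<^sup>2))"
        using that by (auto simp: Lp_loc_2_iff)
      show "(\<lambda>t. (norm (f t + g t))\<^sup>2) \<in> borel_measurable (lebesgue_on {a..b})"
        using that by (intro measurable_restrict_space1) (auto simp: Lp_loc_2_iff)
      have "(norm (f t + g t))\<^sup>2 \<le> 2 * ((norm (f t))\<^sup>2 + (norm (g t))\<^sup>2)" for t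
      proof -
        have "(norm (f t + g t))\<^sup>2 \<le> (norm (f t) + norm (g t))\<^sup>2"
          by (intro power_mono norm_triangle_ineq) simp
        also have "\<dots> \<le> 2 * ((norm (f t))\<^sup>2 + (norm (g t))\<^sup>2)"
          using sum_squares_bound[of "norm (f t)" "norm (g t)"] by (simp add: power2_sum)
        finally show ?thesis .
      qed
      then show "AE t in lebesgue_on {a..b}. norm ((norm (f t + g t))\<^sup>2)
          \<le> norm (2 * ((norm (f t))\<^sup>2 + (norm (g t))\<^sup>2))"
        by (intro AE_I2) simp
    qed
    then show ?thesis
      using that by (auto simp: Lp_loc_2_iff)
  qed
  show "g \<in> Lp_loc 2 UNIV" if "f \<in> Lp_loc 2 UNIV" "AE t in lebesgue. f t = g t" for f g
  proof (rule Lp_loc_2_dominated[OF _ Lp_loc_2_mult[OF that(1) that(1)]])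
    show "g \<in> borel_measurable lebesgue"
      using that by (auto simp: Lp_loc_2_iff intro: borel_measurable_AE)
    show "AE t in lebesgue. (norm (g t))\<^sup>2 \<le> 1 * norm (f t * f t)"
      using that(2) by eventually_elim (simp add: norm_mult power2_eq_square)
  qed
qed (auto simp: Lp_loc_2_iff norm_mult power_mult_distrib)

lemma Lp_loc_infinity_mult:
  assumes "f \<in> Lp_loc \<infinity> UNIV" "g \<in> Lp_loc 2 UNIV"
  shows "(\<lambda>t. f t * g t) \<in> Lp_loc 2 UNIV"
  unfolding Lp_loc_2_iff
proof (intro conjI allI)
  show "(\<lambda>t. f t * g t) \<in> borel_measurable lebesgue"
    using assms unfolding Lp_loc_2_iff Lp_loc_infinity_iff by auto
  fix a b :: real
  obtain C where C: "AE t in lebesgue_on {a..b}. norm (f t) \<le> C"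
    using assms unfolding Lp_loc_infinity_iff by blast
  show "integrable (lebesgue_on {a..b}) (\<lambda>t. (norm (f t * g t))\<^sup>2)"
  proof (rule Bochner_Integration.integrable_bound)
    show "integrable (lebesgue_on {a..b}) (\<lambda>t. C\<^sup>2 * (norm (g t))\<^sup>2)"
      using assms by (auto simp: Lp_loc_2_iff)
    show "(\<lambda>t. (norm (f t * g t))\<^sup>2) \<in> borel_measurable (lebesgue_on {a..b})"
      using assms unfolding Lp_loc_2_iff Lp_loc_infinity_iff
      by (intro measurable_restrict_space1) auto
    show "AE t in lebesgue_on {a..b}. norm ((norm (f t * g t))\<^sup>2) \<le> norm (C\<^sup>2 * (norm (g t))\<^sup>2)"
      using C
    proof eventually_elim
      case (elim t)
      then have "(norm (f t))\<^sup>2 \<le> C\<^sup>2"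
        by (intro power_mono) auto
      then show ?case
        by (auto simp: norm_mult power_mult_distrib intro: mult_right_mono)
    qed
  qed
qed

section \<open>Entrywise closure of matrix functions\<close>

lemma Mats_UNIV_I:
  assumes "\<And>t. A t \<in> carrier_mat m k" "\<And>i j. i < m \<Longrightarrow> j < k \<Longrightarrow> (\<lambda>t. A t $$ (i, j)) \<in> F UNIV"
  shows "A \<in> Mats m k F UNIV"
  using assms by (auto simp: Mats_def)

lemma Mats_UNIV_D:
  assumes "A \<in> Mats m k F UNIV"
  shows "A t \<in> carrier_mat m k" "dim_row (A t) = m" "dim_col (A t) = k"
    "i < m \<Longrightarrow> j < k \<Longrightarrow> (\<lambda>t. A t $$ (i, j)) \<in> F UNIV"
proof -
  show A: "A t \<in> carrier_mat m k"
    using assms by (auto simp: Mats_def)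
  from carrier_matD[OF this] show "dim_row (A t) = m" "dim_col (A t) = k" .
  show "i < m \<Longrightarrow> j < k \<Longrightarrow> (\<lambda>t. A t $$ (i, j)) \<in> F UNIV"
    using assms by (auto simp: Mats_def)
qed

lemma Mats_const:
  assumes "ae_space (F UNIV)" "A \<in> carrier_mat m k" "\<And>c. (\<lambda>t. c) \<in> F UNIV"
  shows "(\<lambda>t. A) \<in> Mats m k F UNIV"
  using assms by (intro Mats_UNIV_I) auto

lemma Mats_AE_cong:
  assumes F: "ae_space (F UNIV)" and A: "A \<in> Mats m k F UNIV"
    and B: "\<And>t. B t \<in> carrier_mat m k" and AB: "AE t in lebesgue. A t = B t"
  shows "B \<in> Mats m k F UNIV"
proof (rule Mats_UNIV_I[OF B])
  fix i j assume "i < m" "j < k"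
  show "(\<lambda>t. B t $$ (i, j)) \<in> F UNIV"
    by (rule ae_spaceD(4)[OF F Mats_UNIV_D(4)[OF A \<open>i < m\<close> \<open>j < k\<close>]])
      (use AB in eventually_elim, simp)
qed

lemma Mats_add:
  assumes F: "ae_space (F UNIV)" and A: "A \<in> Mats m k F UNIV" and B: "B \<in> Mats m k F UNIV"
  shows "(\<lambda>t. A t + B t) \<in> Mats m k F UNIV"
proof (rule Mats_UNIV_I)
  fix i j assume "i < m" "j < k"
  then show "(\<lambda>t. (A t + B t) $$ (i, j)) \<in> F UNIV"
    using ae_spaceD(2)[OF F Mats_UNIV_D(4)[OF A] Mats_UNIV_D(4)[OF B]]
    by (simp add: Mats_UNIV_D(2,3)[OF A] Mats_UNIV_D(2,3)[OF B])
qed (use Mats_UNIV_D(1)[OF A] Mats_UNIV_D(1)[OF B] in simp)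

lemma Mats_smult:
  assumes F: "ae_space (F UNIV)" and A: "A \<in> Mats m k F UNIV"
  shows "(\<lambda>t. c \<cdot>\<^sub>m A t) \<in> Mats m k F UNIV"
proof (rule Mats_UNIV_I)
  fix i j assume "i < m" "j < k"
  then show "(\<lambda>t. (c \<cdot>\<^sub>m A t) $$ (i, j)) \<in> F UNIV"
    using ae_spaceD(3)[OF F Mats_UNIV_D(4)[OF A]] by (simp add: Mats_UNIV_D(2,3)[OF A])
qed (use Mats_UNIV_D(1)[OF A] in simp)

lemma Mats_diff:
  assumes F: "ae_space (F UNIV)" and A: "A \<in> Mats m k F UNIV" and B: "B \<in> Mats m k F UNIV"
  shows "(\<lambda>t. A t - B t) \<in> Mats m k F UNIV"
proof -
  have "A t - B t = A t + (- 1) \<cdot>\<^sub>m B t" for t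
    using Mats_UNIV_D(1)[OF A, of t] Mats_UNIV_D(1)[OF B, of t] by (intro eq_matI) auto
  then show ?thesis
    using Mats_add[OF F A Mats_smult[OF F B]] by simp
qed

text \<open>The two factors and the product may lie in three different spaces, because square
  integrable factors give an integrable product and bounded factors preserve square
  integrability.\<close>

lemma Mats_mult:
  assumes E: "ae_space (E UNIV)" and A: "A \<in> Mats m k F UNIV" and B: "B \<in> Mats k l G UNIV"
    and prod: "\<And>f g. f \<in> F UNIV \<Longrightarrow> g \<in> G UNIV \<Longrightarrow> (\<lambda>t. f t * g t) \<in> E UNIV"
  shows "(\<lambda>t. A t * B t) \<in> Mats m l E UNIV"
proof (rule Mats_UNIV_I)
  note [simp] = Mats_UNIV_D(2,3)[OF A] Mats_UNIV_D(2,3)[OF B]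
  fix i j assume ij: "i < m" "j < l"
  have "(\<lambda>t. \<Sum>r<k. A t $$ (i, r) * B t $$ (r, j)) \<in> E UNIV"
    using ij by (intro ae_space_sum[OF E] prod Mats_UNIV_D(4)[OF A] Mats_UNIV_D(4)[OF B]) auto
  then show "(\<lambda>t. (A t * B t) $$ (i, j)) \<in> E UNIV"
    using ij by (simp add: index_mult_mat_sum del: index_mult_mat(1))
qed (use Mats_UNIV_D(1)[OF A] Mats_UNIV_D(1)[OF B] in \<open>rule mult_carrier_mat\<close>)

lemma Mats_adjoint:
  assumes A: "A \<in> Mats m k F UNIV" and cnj: "\<And>f. f \<in> F UNIV \<Longrightarrow> (\<lambda>t. cnj (f t)) \<in> F UNIV"
  shows "(\<lambda>t. mat_adjoint (A t)) \<in> Mats k m F UNIV"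
proof (rule Mats_UNIV_I)
  fix i j assume "i < k" "j < m"
  then show "(\<lambda>t. mat_adjoint (A t) $$ (i, j)) \<in> F UNIV"
    using cnj[OF Mats_UNIV_D(4)[OF A]] by (simp add: Mats_UNIV_D(2,3)[OF A])
qed (use Mats_UNIV_D(1)[OF A] in simp)

lemma Lp_loc_2_cnj: "f \<in> Lp_loc 2 UNIV \<Longrightarrow> (\<lambda>t. cnj (f t)) \<in> Lp_loc 2 UNIV"
  using measurable_compose[of f lebesgue borel cnj borel]
  by (auto simp: Lp_loc_2_iff borel_measurable_continuous_onI continuous_on_cnj)

lemma Mats_Meas_mult:
  assumes "A \<in> Mats m k Meas UNIV" "B \<in> Mats k l Meas UNIV"
  shows "(\<lambda>t. A t * B t) \<in> Mats m l Meas UNIV"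
  by (rule Mats_mult[where E = Meas, OF ae_space_Meas assms]) auto

section \<open>Measurability of determinants and inverses\<close>

lemma measurable_det:
  assumes A: "A \<in> Mats n n Meas UNIV"
  shows "(\<lambda>t. Determinant.det (A t)) \<in> borel_measurable lebesgue"
proof -
  have "(\<lambda>t. A t $$ (i, p i)) \<in> borel_measurable lebesgue"
    if "p permutes {0..<n}" "i \<in> {0..<n}" for p i
    using Mats_UNIV_D(4)[OF A, of i "p i"] that permutes_in_image[OF that(1), of i] by auto
  then show ?thesis
    unfolding Determinant.det_def Mats_UNIV_D(2,3)[OF A]
    by (auto intro!: borel_measurable_sum borel_measurable_times borel_measurable_prod)
qed

lemma Mats_Meas_inv:
  assumes A: "A \<in> Mats n n Meas UNIV"
  shows "(\<lambda>t. mat_inv (A t)) \<in> Mats n n Meas UNIV"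
proof (rule Mats_UNIV_I)
  fix i j assume ij: "i < n" "j < n"
  have "(\<lambda>t. mat_delete (A t) j i) \<in> Mats (n - 1) (n - 1) Meas UNIV"
    using Mats_UNIV_D[OF A] ij
    by (intro Mats_UNIV_I) (auto simp: mat_delete_def)
  then have cof: "(\<lambda>t. cofactor (A t) j i) \<in> borel_measurable lebesgue"
    unfolding cofactor_def by (intro borel_measurable_times measurable_det) auto
  have "mat_inv (A t) $$ (i, j) =
      (if Determinant.det (A t) = 0 then 0 else cofactor (A t) j i / Determinant.det (A t))" for t
    using ij Mats_UNIV_D(2,3)[OF A, of t] mat_inv_singular[OF Mats_UNIV_D(1)[OF A], of t]
      mat_inv_adj_mat[OF Mats_UNIV_D(1)[OF A], of t]
    by (auto simp: adj_mat_def)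
  moreover have "(\<lambda>t. if Determinant.det (A t) = 0 then 0
      else cofactor (A t) j i / Determinant.det (A t)) \<in> borel_measurable lebesgue"
    using cof measurable_det[OF A] by measurable
  ultimately show "(\<lambda>t. mat_inv (A t) $$ (i, j)) \<in> Meas UNIV"
    by simp
qed (use Mats_UNIV_D(1)[OF A] mat_inv_carrier in auto)

section \<open>Periodic functions\<close>

lemma periodic_int_multiple:
  fixes f :: "real \<Rightarrow> 'a" and k :: int
  assumes "\<And>t. f (t + d) = f t"
  shows "f (t + of_int k * d) = f t"
proof -
  have nat: "f (t + of_nat m * d) = f t" for m t
  proof (induction m)
    case (Suc m)
    have "f (t + of_nat (Suc m) * d) = f ((t + of_nat m * d) + d)"
      by (simp add: algebra_simps)
    then show ?case
      using assms Suc by simp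
  qed simp
  show ?thesis
  proof (cases k)
    case (neg m)
    then have k: "(of_int k :: real) = - of_nat (Suc m)"
      by simp
    \<comment> \<open>A negative multiple is undone by a natural multiple that starts at the shifted
      point.\<close>
    have "t + of_int k * d + of_nat (Suc m) * d = t"
      unfolding k by (simp del: of_nat_Suc)
    then show ?thesis
      using nat[of "t + of_int k * d" "Suc m"] by metis
  qed (simp add: nat)
qed

text \<open>The exceptional set is covered by the translates of a null set by the countably many
  multiples of \<open>d\<close>.\<close>

lemma AE_periodic:
  fixes P :: "real \<Rightarrow> bool"
  assumes d: "0 < d" and per: "\<And>t. P (t + d) = P t" and P: "AE t in lebesgue_on {0<..<d}. P t"
  shows "AE t in lebesgue. P t"
proof -
  have "AE t in lebesgue. t \<in> {0<..<d} \<longrightarrow> P t"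
    using P by (subst (asm) AE_restrict_space_iff) auto
  then obtain N where N: "negligible N" "{t. \<not> (t \<in> {0<..<d} \<longrightarrow> P t)} \<subseteq> N"
    unfolding eventually_ae_filter_negligible by blast
  \<comment> \<open>The representative of a point modulo \<open>d\<close> lies in [0,d) and may be
    0, about which the open interval gives no information; hence \<open>insert 0 N\<close>.\<close>
  have "{t. \<not> P t} \<subseteq> (\<Union>k::int. (+) (of_int k * d) ` insert 0 N)"
  proof
    fix t assume "t \<in> {t. \<not> P t}"
    define k where "k = \<lfloor>t / d\<rfloor>"
    define s where "s = t - of_int k * d"
    have "of_int k \<le> t / d" "t / d < of_int k + 1"
      unfolding k_def by linarith+
    then have "0 \<le> s" "s < d"
      using d by (simp_all add: s_def field_simps)
    moreover have "\<not> P s"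
      using \<open>t \<in> _\<close> periodic_int_multiple[of P d s k, OF per] by (simp add: s_def)
    ultimately have "s \<in> insert 0 N"
      using N(2) by (cases "s = 0") auto
    then show "t \<in> (\<Union>k::int. (+) (of_int k * d) ` insert 0 N)"
      by (auto simp: s_def image_iff intro!: exI[of _ k] bexI[of _ s])
  qed
  moreover have "negligible (\<Union>k::int. (+) (of_int k * d) ` insert 0 N)"
    using N(1) by (intro negligible_countable_Union) (auto intro!: negligible_translation)
  ultimately show ?thesis
    unfolding eventually_ae_filter_negligible by blast
qed

text \<open>Every compact interval lies in a finite chain of translated periods. The gauge integral
  is used for its rules on shifting and joining intervals; for norms of measurable functions it
  decides Lebesgue integrability.\<close>

lemma integrable_on_periodic:
  fixes f :: "real \<Rightarrow> real"
  assumes d: "0 < d" and per: "\<And>t. f (t + d) = f t" and int: "f integrable_on {0..d}"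
  shows "f integrable_on {a..b}"
proof -
  have step: "f integrable_on {of_int k * d..of_int k * d + d}" for k :: int
    using integrable_shift_real_ivl[OF int, of "- (of_int k * d)"]
      periodic_int_multiple[of f d _ "- k", OF per] by (simp add: add.commute)
  have *: "f integrable_on {of_int k * d..of_int k * d + of_nat m * d}" for k :: int and m
  proof (induction m)
    case (Suc m)
    have "f integrable_on {of_int k * d + of_nat m * d..of_int k * d + of_nat (Suc m) * d}"
      using step[of "k + int m"] by (simp add: algebra_simps)
    then show ?case
      using d Suc Henstock_Kurzweil_Integration.integrable_combine[of "of_int k * d"
          "of_int k * d + of_nat m * d" "of_int k * d + of_nat (Suc m) * d" f]
      by (simp add: algebra_simps)
  qed (use integrable_on_refl[of f "of_int k * d"] in simp)
  obtain k :: int where k: "of_int k * d \<le> a"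
    using floor_divide_lower[OF d, of a] by blast
  obtain m :: nat where "(b - of_int k * d) / d \<le> of_nat m"
    using real_arch_simple by blast
  then have "b \<le> of_int k * d + of_nat m * d"
    using d by (simp add: pos_divide_le_eq)
  with k have "{a..b} \<subseteq> {of_int k * d..of_int k * d + of_nat m * d}"
    by auto
  then show ?thesis
    by (rule integrable_on_subinterval[OF *])
qed

section \<open>Spectral theorem for Hermitian matrices\<close>

lemma unitary_right_inverse:
  fixes U :: "complex mat"
  assumes "U \<in> carrier_mat n n" "mat_adjoint U * U = 1\<^sub>m n"
  shows "U * mat_adjoint U = 1\<^sub>m n"
  by (rule mat_mult_left_right_inverse[OF _ assms(1,2)]) (use assms(1) in simp)

lemma exists_eigenvalue:
  fixes A :: "complex mat"
  assumes A: "A \<in> carrier_mat n n" and "n \<noteq> 0"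
  obtains e where "eigenvalue A e"
proof -
  have "degree (char_poly A) \<noteq> 0"
    using degree_monic_char_poly[OF A] assms(2) by simp
  then obtain e where "poly (char_poly A) e = 0"
    using fundamental_theorem_of_algebra[of "char_poly A"] by (auto simp: constant_degree)
  then show ?thesis
    using that eigenvalue_root_char_poly[OF A] by blast
qed

text \<open>Complete \<open>v\<close> to a basis and apply Gram-Schmidt, which keeps the first
  vector. The resulting columns are orthogonal and nonzero, and a diagonal factor normalises them;
  this is where the scalar \<open>c\<close> comes from.\<close>

lemma unitary_with_first_column:
  fixes v :: "complex vec"
  assumes v: "v \<in> carrier_vec n" "v \<noteq> 0\<^sub>v n"
  obtains U c where "U \<in> carrier_mat n n" "mat_adjoint U * U = 1\<^sub>m n" "col U 0 = c \<cdot>\<^sub>v v"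
proof -
  interpret cof_vec_space n "TYPE(complex)" .
  define ws where "ws = gram_schmidt n (basis_completion v)"
  have bc: "set (basis_completion v) \<subseteq> carrier_vec n" "distinct (basis_completion v)"
      "lin_indpt (set (basis_completion v))" "hd (basis_completion v) = v"
      "length (basis_completion v) = n"
    using basis_completion[OF v] by auto
  from bc have n: "n \<noteq> 0"
    using v by (intro notI) auto
  from bc n obtain vs where vs: "basis_completion v = v # vs"
    by (cases "basis_completion v") auto
  have ws: "corthogonal ws" "set ws \<subseteq> carrier_vec n" "length ws = n"
    using gram_schmidt_result[OF bc(1-3) ws_def] bc by auto
  define W where "W = mat_of_cols n ws"
  have W: "W \<in> carrier_mat n n"
    using ws mat_of_cols_carrier(1)[of n ws] by (simp add: W_def)
  have "corthogonal_mat W"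
    using orthogonal_mat_of_cols[OF ws(2,1,3)] by (simp add: W_def)
  then have orth: "\<And>i j. i < n \<Longrightarrow> j < n \<Longrightarrow> i \<noteq> j \<Longrightarrow> (mat_adjoint W * W) $$ (i, j) = 0"
    and nz: "\<And>i. i < n \<Longrightarrow> (mat_adjoint W * W) $$ (i, i) \<noteq> 0"
    using W unfolding corthogonal_mat_def diagonal_mat_def Let_def by auto
  \<comment> \<open>The Euclidean length of column \<open>i\<close>; it is nonzero because the
    diagonal of the Gram matrix of \<open>W\<close> is.\<close>
  define r where "r i = sqrt (\<Sum>k<n. (cmod (W $$ (k, i)))\<^sup>2)" for i
  have diag: "(mat_adjoint W * W) $$ (i, i) = (complex_of_real (r i))\<^sup>2" if "i < n" for i
  proof -
    have "(mat_adjoint W * W) $$ (i, i) = (\<Sum>k<n. complex_of_real ((cmod (W $$ (k, i)))\<^sup>2))"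
      using W that by (simp add: index_mult_mat_sum complex_norm_square[unfolded of_real_power] mult.commute
          del: index_mult_mat(1))
    also have "\<dots> = complex_of_real ((r i)\<^sup>2)"
      by (simp add: r_def sum_nonneg)
    finally show ?thesis by simp
  qed
  define U where "U = W * mat_diag n (\<lambda>i. 1 / complex_of_real (r i))"
  have U: "U = Matrix.mat n n (\<lambda>(i, j). W $$ (i, j) * (1 / complex_of_real (r j)))"
    unfolding U_def by (rule mat_diag_mult_right[OF W])
  have "mat_adjoint U * U = 1\<^sub>m n"
  proof (rule eq_matI)
    fix i j assume "i < dim_row (1\<^sub>m n)" "j < dim_col (1\<^sub>m n :: complex mat)"
    then have ij: "i < n" "j < n" by auto
    have "(mat_adjoint U * U) $$ (i, j) =
        (mat_adjoint W * W) $$ (i, j) / (complex_of_real (r i) * complex_of_real (r j))"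
      using ij W by (simp add: U index_mult_mat_sum sum_divide_distrib del: index_mult_mat(1))
    then show "(mat_adjoint U * U) $$ (i, j) = 1\<^sub>m n $$ (i, j)"
      using ij orth nz diag[of i] by (cases "i = j") (auto simp: power2_eq_square simp del: index_mult_mat(1))
  qed (auto simp: U)
  moreover have "col U 0 = (1 / complex_of_real (r 0)) \<cdot>\<^sub>v v"
  proof -
    have "col W 0 = ws ! 0"
      using ws n unfolding W_def by (intro col_mat_of_cols) auto
    also have "\<dots> = v"
      using gram_schmidt_hd[OF v(1), of vs] ws(3) n unfolding ws_def vs
      by (metis hd_conv_nth list.size(3))
    finally have "col W 0 = v" .
    moreover have "col U 0 = (1 / complex_of_real (r 0)) \<cdot>\<^sub>v col W 0"
      using n W by (intro eq_vecI) (auto simp: U)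
    ultimately show ?thesis by simp
  qed
  moreover have "U \<in> carrier_mat n n"
    by (simp add: U)
  ultimately show ?thesis
    using that by blast
qed

lemma mat_adjoint_four_block:
  fixes A B C D :: "complex mat"
  assumes "A \<in> carrier_mat k l" "B \<in> carrier_mat k m" "C \<in> carrier_mat p l" "D \<in> carrier_mat p m"
  shows "mat_adjoint (four_block_mat A B C D) =
    four_block_mat (mat_adjoint A) (mat_adjoint C) (mat_adjoint B) (mat_adjoint D)"
  by (rule eq_matI) (use assms in auto)

text \<open>Deflation by induction on the size: in an orthonormal basis that starts with an
  eigenvector, a Hermitian matrix splits into a scalar and a smaller Hermitian block. The values
  \<open>l\<close> are left complex; their sign and reality are obtained later from
  positivity.\<close>

lemma hermitian_diagonalization:
  fixes A :: "complex mat"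
  assumes "A \<in> carrier_mat n n" "mat_adjoint A = A"
  shows "\<exists>U l. U \<in> carrier_mat n n \<and> mat_adjoint U * U = 1\<^sub>m n \<and> A = U * mat_diag n l * mat_adjoint U"
  using assms
proof (induction n arbitrary: A)
  case 0
  then show ?case
    by (intro exI[of _ "1\<^sub>m 0"] exI[of _ "\<lambda>_. 0"]) (auto intro!: eq_matI)
next
  case (Suc n)
  let ?n = "Suc n"
  obtain e where "eigenvalue A e"
    using exists_eigenvalue[OF Suc.prems(1)] by blast
  then obtain v where v: "v \<in> carrier_vec ?n" "v \<noteq> 0\<^sub>v ?n" "A *\<^sub>v v = e \<cdot>\<^sub>v v"
    using Suc.prems(1) by (auto simp: eigenvalue_def eigenvector_def)
  obtain P c where P: "P \<in> carrier_mat ?n ?n" "mat_adjoint P * P = 1\<^sub>m ?n" "col P 0 = c \<cdot>\<^sub>v v"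
    using unitary_with_first_column[OF v(1,2)] by blast
  note P' = unitary_right_inverse[OF P(1,2)]
  note [simp] = carrier_matD[OF P(1)] carrier_matD[OF Suc.prems(1)]
  define B where "B = mat_adjoint P * (A * P)"
  have B: "B \<in> carrier_mat ?n ?n"
    by (rule carrier_matI) (simp_all add: B_def)
  note [simp] = carrier_matD[OF B]
  have B_herm: "mat_adjoint B = B"
    using Suc.prems by (simp add: B_def mat_adjoint_mult mat_mult_assoc)
  have A_eq: "A = P * B * mat_adjoint P"
  proof -
    have "P * B * mat_adjoint P = (P * mat_adjoint P) * A * (P * mat_adjoint P)"
      by (simp add: B_def mat_mult_assoc)
    then show ?thesis
      using Suc.prems by (simp add: P')
  qed
  have B0: "B $$ (i, 0) = (if i = 0 then e else 0)" if "i < ?n" for i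
  proof -
    have eig: "A *\<^sub>v col P 0 = e \<cdot>\<^sub>v col P 0"
      using v Suc.prems(1) by (simp add: P(3) mult_mat_vec smult_smult_assoc mult.commute)
    have AP: "(A * P) $$ (k, 0) = e * P $$ (k, 0)" if "k < ?n" for k
      using arg_cong[OF eig, of "\<lambda>w. w $ k"] that by simp
    have "B $$ (i, 0) = (\<Sum>k<?n. mat_adjoint P $$ (i, k) * (A * P) $$ (k, 0))"
      unfolding B_def using that by (subst index_mult_mat_sum) simp_all
    also have "\<dots> = (\<Sum>k<?n. e * (mat_adjoint P $$ (i, k) * P $$ (k, 0)))"
      by (intro sum.cong) (simp_all add: AP del: index_mult_mat(1))
    also have "\<dots> = e * (mat_adjoint P * P) $$ (i, 0)"
      using that by (subst index_mult_mat_sum) (simp_all add: sum_distrib_left del: sum.lessThan_Suc)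
    finally have "B $$ (i, 0) = e * (mat_adjoint P * P) $$ (i, 0)" .
    then show ?thesis
      using that by (simp add: P(2))
  qed
  \<comment> \<open>Hermitian symmetry carries the zeros of the first column over to the first row;
    this makes the matrix block diagonal rather than merely block triangular.\<close>
  have B0': "B $$ (0, i) = 0" if "i < ?n" "0 < i" for i
    using B0[OF that(1)] that arg_cong[OF B_herm, of "\<lambda>M. M $$ (0, i)"] by auto
  define C where "C = Matrix.mat n n (\<lambda>(i, j). B $$ (Suc i, Suc j))"
  have B_eq: "B = four_block_mat (Matrix.mat 1 1 (\<lambda>_. e)) (0\<^sub>m 1 n) (0\<^sub>m n 1) C"
    by (rule eq_matI) (auto simp: C_def B0 B0')
  have "mat_adjoint C = C"
  proof (rule eq_matI)
    fix i j assume "i < dim_row C" "j < dim_col C"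
    then show "mat_adjoint C $$ (i, j) = C $$ (i, j)"
      using arg_cong[OF B_herm, of "\<lambda>M. M $$ (Suc i, Suc j)"] by (simp add: C_def)
  qed (auto simp: C_def)
  then obtain U l where U: "U \<in> carrier_mat n n" "mat_adjoint U * U = 1\<^sub>m n"
    and C_eq: "C = U * mat_diag n l * mat_adjoint U"
    using Suc.IH[of C] by (auto simp: C_def)
  \<comment> \<open>The diagonalizing unitary of the smaller block, extended by the identity on the
    eigenvector. The diagonal is extended accordingly by \<open>case_nat e l\<close>.\<close>
  define Q where "Q = four_block_mat (1\<^sub>m 1) (0\<^sub>m 1 n) (0\<^sub>m n 1) U"
  have Q: "Q \<in> carrier_mat ?n ?n"
    using U four_block_carrier_mat[of "1\<^sub>m 1" 1 1 U n n] by (simp add: Q_def)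
  note [simp] = carrier_matD[OF Q]
  have Q_adj: "mat_adjoint Q = four_block_mat (1\<^sub>m 1) (0\<^sub>m 1 n) (0\<^sub>m n 1) (mat_adjoint U)"
    unfolding Q_def by (subst mat_adjoint_four_block[of _ 1 1 _ n _ n]) (use U in \<open>auto intro!: eq_matI\<close>)
  have QQ: "mat_adjoint Q * Q = 1\<^sub>m ?n"
    unfolding Q_adj unfolding Q_def
    by (subst mult_four_block_mat[of _ 1 1 _ n _ n _ _ 1 _ n]) (use U four_block_one_mat[of 1 n] in auto)
  have D: "mat_diag ?n (case_nat e l) =
      four_block_mat (Matrix.mat 1 1 (\<lambda>_. e)) (0\<^sub>m 1 n) (0\<^sub>m n 1) (mat_diag n l)"
    by (rule eq_matI) (auto simp: mat_diag_def split: nat.splits)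
  have UD: "U * mat_diag n l \<in> carrier_mat n n"
    by (rule mult_carrier_mat[OF U(1) mat_diag_dim])
  have "Q * mat_diag ?n (case_nat e l) =
      four_block_mat (Matrix.mat 1 1 (\<lambda>_. e)) (0\<^sub>m 1 n) (0\<^sub>m n 1) (U * mat_diag n l)"
    unfolding D Q_def
    by (subst mult_four_block_mat[of _ 1 1 _ n _ n _ _ 1 _ n])
      (use U in \<open>auto simp: left_mult_zero_mat[OF mat_diag_dim]\<close>)
  then have "Q * mat_diag ?n (case_nat e l) * mat_adjoint Q =
      four_block_mat (Matrix.mat 1 1 (\<lambda>_. e)) (0\<^sub>m 1 n) (0\<^sub>m n 1) (U * mat_diag n l) *
      four_block_mat (1\<^sub>m 1) (0\<^sub>m 1 n) (0\<^sub>m n 1) (mat_adjoint U)"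
    by (simp only: Q_adj)
  also have "\<dots> = B"
    unfolding B_eq C_eq using UD mult_carrier_mat[OF UD mat_adjoint_carrier[OF U(1)]]
    by (subst mult_four_block_mat[of _ 1 1 _ n _ n _ _ 1 _ n])
      (auto simp: U(1) right_mult_zero_mat[OF UD]
          left_mult_zero_mat[OF mat_adjoint_carrier[OF U(1)]])
  finally have B_diag: "B = Q * mat_diag ?n (case_nat e l) * mat_adjoint Q" ..
  have "mat_adjoint (P * Q) * (P * Q) = mat_adjoint Q * (mat_adjoint P * P) * Q"
    by (simp add: mat_adjoint_mult mat_mult_assoc)
  also have "\<dots> = 1\<^sub>m ?n"
    using Q by (simp add: P(2) QQ)
  finally have "mat_adjoint (P * Q) * (P * Q) = 1\<^sub>m ?n" .
  moreover have "A = P * Q * mat_diag ?n (case_nat e l) * mat_adjoint (P * Q)"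
    unfolding A_eq B_diag
    using carrier_matD[OF mat_diag_dim[of ?n "case_nat e l"]]
    by (simp add: mat_adjoint_mult mat_mult_assoc)
  moreover have "P * Q \<in> carrier_mat ?n ?n"
    by (rule mult_carrier_mat[OF P(1) Q])
  ultimately show ?case
    by blast
qed

section \<open>Positive square roots\<close>

lemma diag_conj_index:
  fixes U :: "complex mat"
  assumes U: "U \<in> carrier_mat m n" and "i < m" "j < m"
  shows "(U * mat_diag n l * mat_adjoint U) $$ (i, j) = (\<Sum>r<n. l r * (U $$ (i, r) * cnj (U $$ (j, r))))"
proof -
  have "(U * mat_diag n l * mat_adjoint U) $$ (i, j) =
      (\<Sum>r<n. (U * mat_diag n l) $$ (i, r) * mat_adjoint U $$ (r, j))"
    using assms carrier_matD[OF mat_diag_dim[of n l]] by (subst index_mult_mat_sum) auto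
  also have "\<dots> = (\<Sum>r<n. l r * (U $$ (i, r) * cnj (U $$ (j, r))))"
    using assms by (intro sum.cong) (auto simp: mat_diag_mult_right[OF U])
  finally show ?thesis .
qed

text \<open>The inner factor \<open>mat_adjoint U * U\<close> cancels. Together with the power law
  below, this is polynomial functional calculus for a fixed diagonalization.\<close>

lemma diag_conj_mult:
  fixes U :: "complex mat"
  assumes U: "U \<in> carrier_mat n n" "mat_adjoint U * U = 1\<^sub>m n"
  shows "(U * mat_diag n l * mat_adjoint U) * (U * mat_diag n m * mat_adjoint U) =
    U * mat_diag n (\<lambda>i. l i * m i) * mat_adjoint U"
proof -
  note [simp] = carrier_matD[OF U(1)] carrier_matD[OF mat_diag_dim[of n l]]
    carrier_matD[OF mat_diag_dim[of n m]] carrier_matD[OF mat_diag_dim[of n "\<lambda>i. l i * m i"]]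
  have "(U * mat_diag n l * mat_adjoint U) * (U * mat_diag n m * mat_adjoint U) =
      U * (mat_diag n l * ((mat_adjoint U * U) * (mat_diag n m * mat_adjoint U)))"
    by (simp add: mat_mult_assoc)
  also have "\<dots> = U * (mat_diag n l * (mat_diag n m * mat_adjoint U))"
    unfolding U(2)
    by (simp only: left_mult_one_mat[OF mult_carrier_mat[OF mat_diag_dim mat_adjoint_carrier[OF U(1)]]])
  also have "\<dots> = U * ((mat_diag n l * mat_diag n m) * mat_adjoint U)"
    by (simp only: mat_mult_assoc carrier_matD[OF U(1)] dim_mat_adjoint
        carrier_matD[OF mat_diag_dim[of n l]] carrier_matD[OF mat_diag_dim[of n m]])
  also have "\<dots> = U * mat_diag n (\<lambda>i. l i * m i) * mat_adjoint U"
    by (simp add: mat_mult_assoc)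
  finally show ?thesis .
qed

lemma diag_conj_pow:
  fixes U :: "complex mat"
  assumes U: "U \<in> carrier_mat n n" "mat_adjoint U * U = 1\<^sub>m n"
  shows "(U * mat_diag n l * mat_adjoint U) ^\<^sub>m k = U * mat_diag n (\<lambda>i. l i ^ k) * mat_adjoint U"
proof (induction k)
  case 0
  then show ?case
    using U unitary_right_inverse[OF U] by simp
next
  case (Suc k)
  then show ?case
    by (simp add: diag_conj_mult[OF U] power_commutes mult.commute)
qed

text \<open>For each \<open>m\<close>, Stone-Weierstrass gives a polynomial within 1/(m+1) of the
  square root on [0,m]. The intervals grow, so a fixed point is covered from some \<open>m\<close>
  on. One sequence thus serves every nonnegative number, and later every eigenvalue of every matrix
  \<open>W\<^sub>2\<^sub>2\<close> simultaneously.\<close>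

lemma sqrt_polynomial_approximation:
  obtains a :: "nat \<Rightarrow> nat \<Rightarrow> real" and N :: "nat \<Rightarrow> nat"
  where "\<And>x. 0 \<le> x \<Longrightarrow> (\<lambda>m. \<Sum>k\<le>N m. a m k * x ^ k) \<longlonglongrightarrow> sqrt x"
proof -
  have "\<exists>a N. \<forall>x\<in>{0..real m}. \<bar>sqrt x - (\<Sum>k\<le>(N::nat). a k * x ^ k)\<bar> < inverse (real (Suc m))" for m
  proof -
    obtain g where "real_polynomial_function g"
      "\<And>x. x \<in> {0..real m} \<Longrightarrow> \<bar>sqrt x - g x\<bar> < inverse (real (Suc m))"
      by (rule Stone_Weierstrass_real_polynomial_function[of "{0..real m}" sqrt "inverse (real (Suc m))"])
        (auto intro!: continuous_intros)
    then show ?thesis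
      unfolding real_polynomial_function_iff_sum by blast
  qed
  then obtain a N where aN: "\<And>m x. x \<in> {0..real m} \<Longrightarrow>
      \<bar>sqrt x - (\<Sum>k\<le>(N m::nat). a m k * x ^ k)\<bar> < inverse (real (Suc m))"
    by metis
  have "(\<lambda>m. \<Sum>k\<le>N m. a m k * x ^ k) \<longlonglongrightarrow> sqrt x" if "0 \<le> x" for x
  proof -
    obtain M :: nat where M: "x \<le> real M"
      using real_arch_simple by blast
    have "(\<lambda>m. (\<Sum>k\<le>N m. a m k * x ^ k) - sqrt x) \<longlonglongrightarrow> 0"
    proof (rule Lim_null_comparison[OF _ LIMSEQ_inverse_real_of_nat])
      show "\<forall>\<^sub>F m in sequentially. norm ((\<Sum>k\<le>N m. a m k * x ^ k) - sqrt x) \<le> inverse (real (Suc m))"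
      proof (rule eventually_sequentiallyI[of M])
        fix m assume "M \<le> m"
        then have "x \<in> {0..real m}"
          using M that by auto
        from aN[OF this]
        show "norm ((\<Sum>k\<le>N m. a m k * x ^ k) - sqrt x) \<le> inverse (real (Suc m))"
          by (simp add: abs_minus_commute)
      qed
    qed
    then show ?thesis
      by (simp add: LIM_zero_iff)
  qed
  then show ?thesis
    using that by blast
qed

lemma psd_one: "psd (1\<^sub>m n)"
  by (auto simp: psd_def square_mat.simps)

lemma psd_gram:
  fixes P :: "complex mat"
  assumes "P \<in> carrier_mat m n"
  shows "psd (mat_adjoint P * P)"
  using psd_congruence[OF one_carrier_mat psd_one assms] assms by simp

text \<open>The eigenvalues are the diagonal entries of the congruent matrix
  \<open>mat_adjoint U * A * U\<close>, hence real and nonnegative.\<close>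

lemma psd_diagonalization:
  assumes A: "A \<in> carrier_mat n n" "psd A"
  obtains U x where "U \<in> carrier_mat n n" "mat_adjoint U * U = 1\<^sub>m n"
    "A = U * mat_diag n (\<lambda>i. complex_of_real (x i)) * mat_adjoint U" "\<And>i. i < n \<Longrightarrow> 0 \<le> x i"
proof -
  from A have "mat_adjoint A = A"
    by (simp add: psd_def)
  then obtain U l where U: "U \<in> carrier_mat n n" "mat_adjoint U * U = 1\<^sub>m n"
    and A_eq: "A = U * mat_diag n l * mat_adjoint U"
    using hermitian_diagonalization[OF A(1)] by blast
  note [simp] = carrier_matD[OF U(1)] carrier_matD[OF mat_diag_dim[of n l]]
  have "mat_adjoint U * A * U = (mat_adjoint U * U) * mat_diag n l * (mat_adjoint U * U)"
    by (simp add: A_eq mat_mult_assoc)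
  also have "\<dots> = mat_diag n l"
    by (simp add: U(2))
  finally have "psd (mat_diag n l)"
    using psd_congruence[OF A U(1)] by simp
  then have l: "0 \<le> l i" if "i < n" for i
    using psd_diag[OF mat_diag_dim, of n l i] that by (simp add: mat_diag_def)
  have "mat_diag n l = mat_diag n (\<lambda>i. complex_of_real (Re (l i)))"
    using l by (intro eq_matI) (auto simp: mat_diag_def less_eq_complex_def complex_eq_iff)
  with A_eq U l show ?thesis
    by (intro that[of U "\<lambda>i. Re (l i)"]) (auto simp: less_eq_complex_def)
qed

lemma psd_root_exists:
  assumes A: "A \<in> carrier_mat n n" "psd A"
  shows "\<exists>B. B \<in> carrier_mat n n \<and> psd B \<and> B * B = A"
proof -
  obtain U x where U: "U \<in> carrier_mat n n" "mat_adjoint U * U = 1\<^sub>m n"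
    and A_eq: "A = U * mat_diag n (\<lambda>i. complex_of_real (x i)) * mat_adjoint U"
    and x: "\<And>i. i < n \<Longrightarrow> 0 \<le> x i"
    using psd_diagonalization[OF A] by blast
  \<comment> \<open>Fourth roots of the eigenvalues: with them the candidate square root
    \<open>?B\<close> is the Gram matrix of \<open>D * mat_adjoint U\<close>, and is therefore
    positive semidefinite.\<close>
  define D where "D = mat_diag n (\<lambda>i. complex_of_real (sqrt (sqrt (x i))))"
  note [simp] = carrier_matD[OF U(1)]
  have D [simp]: "dim_row D = n" "dim_col D = n"
    by (simp_all add: D_def mat_diag_def)
  let ?B = "U * mat_diag n (\<lambda>i. complex_of_real (sqrt (x i))) * mat_adjoint U"
  have D_adj: "mat_adjoint D = D"
    by (rule eq_matI) (auto simp: D_def mat_diag_def)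
  have DD: "D * D = mat_diag n (\<lambda>i. complex_of_real (sqrt (x i)))"
    unfolding D_def mat_diag_diag
    by (rule eq_matI) (use x in \<open>auto simp: mat_diag_def simp flip: of_real_mult\<close>)
  have "mat_adjoint (D * mat_adjoint U) * (D * mat_adjoint U) = U * (D * D) * mat_adjoint U"
    by (simp add: mat_adjoint_mult D_adj mat_mult_assoc)
  then have "psd ?B"
    using psd_gram[of "D * mat_adjoint U" n n] unfolding DD by (simp add: carrier_matI)
  moreover have "?B * ?B = A"
    unfolding diag_conj_mult[OF U] A_eq
    by (intro arg_cong2[of _ _ _ _ "(*)"] refl eq_matI)
      (use x in \<open>auto simp: mat_diag_def simp flip: of_real_mult\<close>)
  moreover have "?B \<in> carrier_mat n n"
    by (rule carrier_matI) simp_all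
  ultimately show ?thesis
    by blast
qed

text \<open>A positive root \<open>B\<close> is a pointwise limit of fixed polynomials in \<open>B * B\<close>. This gives both its
  uniqueness and its measurable dependence on parameters.\<close>

lemma psd_root_limit:
  fixes a :: "nat \<Rightarrow> nat \<Rightarrow> real" and N :: "nat \<Rightarrow> nat"
  assumes lim: "\<And>x. 0 \<le> x \<Longrightarrow> (\<lambda>m. \<Sum>k\<le>N m. a m k * x ^ k) \<longlonglongrightarrow> sqrt x"
    and B: "B \<in> carrier_mat n n" "psd B" and ij: "i < n" "j < n"
  shows "(\<lambda>m. \<Sum>k\<le>N m. complex_of_real (a m k) * ((B * B) ^\<^sub>m k) $$ (i, j)) \<longlonglongrightarrow> B $$ (i, j)"
proof -
  obtain U x where U: "U \<in> carrier_mat n n" "mat_adjoint U * U = 1\<^sub>m n"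
    and B_eq: "B = U * mat_diag n (\<lambda>i. complex_of_real (x i)) * mat_adjoint U"
    and x: "\<And>i. i < n \<Longrightarrow> 0 \<le> x i"
    using psd_diagonalization[OF B] by blast
  let ?u = "\<lambda>r. U $$ (i, r) * cnj (U $$ (j, r))"
  have "(\<Sum>k\<le>N m. complex_of_real (a m k) * ((B * B) ^\<^sub>m k) $$ (i, j)) =
      (\<Sum>r<n. complex_of_real (\<Sum>k\<le>N m. a m k * ((x r)\<^sup>2) ^ k) * ?u r)" for m
  proof -
    have "(\<Sum>k\<le>N m. complex_of_real (a m k) * ((B * B) ^\<^sub>m k) $$ (i, j)) =
        (\<Sum>k\<le>N m. \<Sum>r<n. complex_of_real (a m k * ((x r)\<^sup>2) ^ k) * ?u r)"
      unfolding B_eq diag_conj_mult[OF U] diag_conj_pow[OF U] diag_conj_index[OF U(1) ij]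
      by (simp add: sum_distrib_left power2_eq_square mult.assoc)
    also have "\<dots> = (\<Sum>r<n. \<Sum>k\<le>N m. complex_of_real (a m k * ((x r)\<^sup>2) ^ k) * ?u r)"
      by (rule sum.swap)
    finally show ?thesis
      by (simp add: sum_distrib_right)
  qed
  moreover have "(\<lambda>m. \<Sum>r<n. complex_of_real (\<Sum>k\<le>N m. a m k * ((x r)\<^sup>2) ^ k) * ?u r)
      \<longlonglongrightarrow> (\<Sum>r<n. complex_of_real (sqrt ((x r)\<^sup>2)) * ?u r)"
    by (intro tendsto_sum tendsto_mult tendsto_of_real lim tendsto_const) auto
  \<comment> \<open>Positivity of \<open>B\<close> enters here: the root of the squared eigenvalue
    is the eigenvalue itself and not merely its absolute value.\<close>
  moreover have "(\<Sum>r<n. complex_of_real (sqrt ((x r)\<^sup>2)) * ?u r) = B $$ (i, j)"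
    unfolding B_eq diag_conj_index[OF U(1) ij] by (intro sum.cong) (auto simp: x)
  ultimately show ?thesis
    by simp
qed

lemma psd_root_unique:
  assumes "B \<in> carrier_mat n n" "psd B" "C \<in> carrier_mat n n" "psd C" "B * B = C * C"
  shows "B = C"
proof (rule eq_matI)
  obtain a :: "nat \<Rightarrow> nat \<Rightarrow> real" and N :: "nat \<Rightarrow> nat"
    where lim: "\<And>x. 0 \<le> x \<Longrightarrow> (\<lambda>m. \<Sum>k\<le>N m. a m k * x ^ k) \<longlonglongrightarrow> sqrt x"
    using sqrt_polynomial_approximation by blast
  fix i j assume "i < dim_row C" "j < dim_col C"
  then have ij: "i < n" "j < n"
    using assms by auto
  show "B $$ (i, j) = C $$ (i, j)"
    using psd_root_limit[OF lim assms(1,2) ij] psd_root_limit[OF lim assms(3,4) ij]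
    unfolding assms(5) by (rule LIMSEQ_unique)
qed (use assms in auto)

lemma psd_sqrt:
  assumes A: "A \<in> carrier_mat n n" "psd A"
  shows "psd_sqrt A \<in> carrier_mat n n" "psd (psd_sqrt A)" "psd_sqrt A * psd_sqrt A = A"
proof -
  have "\<exists>!B. B \<in> carrier_mat (dim_row A) (dim_row A) \<and> psd B \<and> B * B = A"
    using psd_root_exists[OF A] psd_root_unique[of _ n] A by auto
  from theI'[OF this] show "psd_sqrt A \<in> carrier_mat n n" "psd (psd_sqrt A)" "psd_sqrt A * psd_sqrt A = A"
    using A by (auto simp: psd_sqrt_def)
qed

lemma psd_sqrt_carrier:
  assumes "A \<in> carrier_mat n n"
  shows "psd_sqrt A \<in> carrier_mat n n"
  using psd_sqrt(1)[OF assms] assms by (cases "psd A") (auto simp: psd_sqrt_def)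

lemma Mats_Meas_pow:
  assumes A: "A \<in> Mats n n Meas UNIV"
  shows "(\<lambda>t. A t ^\<^sub>m k) \<in> Mats n n Meas UNIV"
proof (induction k)
  case 0
  then show ?case
    using Mats_UNIV_D(1,2)[OF A] by (intro Mats_UNIV_I) auto
next
  case (Suc k)
  then show ?case
    using Mats_Meas_mult[OF Suc A] by simp
qed

lemma Mats_Meas_psd_sqrt:
  assumes A: "A \<in> Mats n n Meas UNIV" and "AE t in lebesgue. psd (A t)"
  shows "(\<lambda>t. psd_sqrt (A t)) \<in> Mats n n Meas UNIV"
proof -
  \<comment> \<open>Where \<open>A t\<close> fails to be positive, it is replaced by the identity,
    so that the polynomial limit exists at every point. The change affects a null set only.\<close>
  define B where "B t = (if psd (A t) then A t else 1\<^sub>m n)" for t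
  have AB: "AE t in lebesgue. A t = B t"
    using assms(2) by eventually_elim (simp add: B_def)
  have B_carrier: "B t \<in> carrier_mat n n" for t
    using Mats_UNIV_D(1)[OF A] by (simp add: B_def)
  have B_psd: "psd (B t)" for t
    by (simp add: B_def psd_one)
  have B: "B \<in> Mats n n Meas UNIV"
    by (rule Mats_AE_cong[OF ae_space_Meas A B_carrier AB])
  note sqrt = psd_sqrt[OF B_carrier B_psd]
  obtain a :: "nat \<Rightarrow> nat \<Rightarrow> real" and N :: "nat \<Rightarrow> nat"
    where lim: "\<And>x. 0 \<le> x \<Longrightarrow> (\<lambda>m. \<Sum>k\<le>N m. a m k * x ^ k) \<longlonglongrightarrow> sqrt x"
    using sqrt_polynomial_approximation by blast
  have "(\<lambda>t. psd_sqrt (B t)) \<in> Mats n n Meas UNIV"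
  proof (rule Mats_UNIV_I)
    fix i j assume ij: "i < n" "j < n"
    have "(\<lambda>t. psd_sqrt (B t) $$ (i, j)) \<in> borel_measurable lebesgue"
    proof (rule borel_measurable_LIMSEQ_metric)
      show "(\<lambda>t. \<Sum>k\<le>N m. complex_of_real (a m k) * (B t ^\<^sub>m k) $$ (i, j)) \<in> borel_measurable lebesgue" for m
        using Mats_UNIV_D(4)[OF Mats_Meas_pow[OF B] ij] by auto
      show "(\<lambda>m. \<Sum>k\<le>N m. complex_of_real (a m k) * (B t ^\<^sub>m k) $$ (i, j))
          \<longlonglongrightarrow> psd_sqrt (B t) $$ (i, j)" for t
        using psd_root_limit[OF lim sqrt(1,2) ij] by (simp add: sqrt(3))
    qed
    then show "(\<lambda>t. psd_sqrt (B t) $$ (i, j)) \<in> Meas UNIV"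
      by simp
  qed (rule sqrt)
  moreover have "AE t in lebesgue. psd_sqrt (B t) = psd_sqrt (A t)"
    using AB by eventually_elim simp
  ultimately show ?thesis
    by (rule Mats_AE_cong[where F = Meas, OF ae_space_Meas _ psd_sqrt_carrier[OF Mats_UNIV_D(1)[OF A]]])
qed

section \<open>Resolvent estimates\<close>

lemma smult_mat_mult_vec:
  fixes A :: "'a :: comm_semiring_0 mat"
  assumes "A \<in> carrier_mat m k" "v \<in> carrier_vec k"
  shows "(c \<cdot>\<^sub>m A) *\<^sub>v v = c \<cdot>\<^sub>v (A *\<^sub>v v)"
  by (rule eq_vecI) (use assms in \<open>auto simp: scalar_prod_def sum_distrib_left mult.assoc\<close>)

text \<open>For a kernel vector \<open>v\<close>, the form of \<open>K\<close> at \<open>v\<close>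
  equals \<open>z\<close> times the squared length of \<open>S *\<^sub>v v\<close>. The former is
  real and \<open>z\<close> is not, so \<open>S *\<^sub>v v\<close> vanishes, which contradicts the
  invertibility of \<open>S * S\<close>.\<close>

lemma pencil_det_nonzero:
  fixes K S :: "complex mat"
  assumes K: "K \<in> carrier_mat m m" "mat_adjoint K = K" and S: "S \<in> carrier_mat m m" "mat_adjoint S = S"
    and det: "Determinant.det (S * S) \<noteq> 0" and z: "z \<notin> \<real>"
  shows "Determinant.det (K - z \<cdot>\<^sub>m (S * S)) \<noteq> 0"
proof
  have SS: "S * S \<in> carrier_mat m m"
    by (rule mult_carrier_mat[OF S(1) S(1)])
  assume "Determinant.det (K - z \<cdot>\<^sub>m (S * S)) = 0"
  then obtain v where v: "v \<in> carrier_vec m" "v \<noteq> 0\<^sub>v m"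
    and "(K - z \<cdot>\<^sub>m (S * S)) *\<^sub>v v = 0\<^sub>v m"
    using det_0_iff_vec_prod_zero_field[of "K - z \<cdot>\<^sub>m (S * S)" m] SS
    by (metis minus_carrier_mat smult_carrier_mat)
  moreover have "(K - z \<cdot>\<^sub>m (S * S)) *\<^sub>v v = K *\<^sub>v v - z \<cdot>\<^sub>v (S *\<^sub>v (S *\<^sub>v v))"
    using minus_mult_distrib_mat_vec[OF K(1) smult_carrier_mat[OF SS] v(1), of z]
      smult_mat_mult_vec[OF SS v(1)] assoc_mult_mat_vec[OF S(1) S(1) v(1)]
    by simp
  ultimately have eq0: "K *\<^sub>v v - z \<cdot>\<^sub>v (S *\<^sub>v (S *\<^sub>v v)) = 0\<^sub>v m"
    by simp
  have Kv: "K *\<^sub>v v = z \<cdot>\<^sub>v (S *\<^sub>v (S *\<^sub>v v))"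
  proof (rule eq_vecI)
    fix i assume "i < dim_vec (z \<cdot>\<^sub>v (S *\<^sub>v (S *\<^sub>v v)))"
    then have "i < m" using S by simp
    then show "(K *\<^sub>v v) $ i = (z \<cdot>\<^sub>v (S *\<^sub>v (S *\<^sub>v v))) $ i"
      using arg_cong[OF eq0, of "\<lambda>w. w $ i"] K S by (simp del: index_mult_mat_vec)
  qed (use K S in simp)
  have Sv: "S *\<^sub>v v \<in> carrier_vec m" "S *\<^sub>v (S *\<^sub>v v) \<in> carrier_vec m"
    using S v by auto
  define s where "s = (S *\<^sub>v v) \<bullet>c (S *\<^sub>v v)"
  have s: "0 \<le> s"
    unfolding s_def by (rule conjugate_square_ge_0_vec)
  have "(K *\<^sub>v v) \<bullet>c v = z * s"
    using adjoint_cscalar_prod[OF S(1) Sv(1) v(1)] Sv v(1) unfolding Kv s_def S(2) by simp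
  moreover have "(K *\<^sub>v v) \<bullet>c v = cnj ((K *\<^sub>v v) \<bullet>c v)"
  proof -
    have Kv_carrier: "K *\<^sub>v v \<in> carrier_vec m"
      using K v by auto
    have "(K *\<^sub>v v) \<bullet>c v = v \<bullet>c (K *\<^sub>v v)"
      using adjoint_cscalar_prod[OF K(1) v(1) v(1)] unfolding K(2) .
    also have "v \<bullet>c w = cnj (w \<bullet>c v)" if "w \<in> carrier_vec m" for w
      using that v(1) by (simp add: scalar_prod_def mult.commute)
    note this[OF Kv_carrier]
    finally show ?thesis .
  qed
  ultimately have "Im (z * s) = 0"
    by (metis Reals_cnj_iff complex_is_Real_iff)
  then have "s = 0"
    using s z by (auto simp: less_eq_complex_def complex_is_Real_iff complex_eq_iff)
  then have "S *\<^sub>v v = 0\<^sub>v m"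
    using Sv unfolding s_def by (simp add: conjugate_square_eq_0_vec)
  moreover have "S *\<^sub>v 0\<^sub>v m = 0\<^sub>v m"
    by (rule eq_vecI) (use S(1) in auto)
  ultimately have "(S * S) *\<^sub>v v = 0\<^sub>v m"
    using assoc_mult_mat_vec[OF S(1) S(1) v(1)] by simp
  then show False
    using det det_0_iff_vec_prod_zero_field[OF SS] v by blast
qed

section \<open>Gram matrices and entrywise resolvent bounds\<close>

lemma gram_diag:
  fixes Q :: "complex mat"
  assumes "j < dim_col Q"
  shows "(mat_adjoint Q * Q) $$ (j, j) = complex_of_real (\<Sum>i<dim_row Q. (cmod (Q $$ (i, j)))\<^sup>2)"
  using assms by (simp add: index_mult_mat_sum complex_norm_square[unfolded of_real_power] mult.commute
      del: index_mult_mat(1))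

text \<open>An entry is at most the length of its column. In this way relations known only on the
  diagonal control all entries.\<close>

lemma gram_diag_ge:
  fixes Q :: "complex mat"
  assumes "i < dim_row Q" "j < dim_col Q"
  shows "(cmod (Q $$ (i, j)))\<^sup>2 \<le> Re ((mat_adjoint Q * Q) $$ (j, j))"
  unfolding gram_diag[OF assms(2)]
  using member_le_sum[of i "{..<dim_row Q}" "\<lambda>i. (cmod (Q $$ (i, j)))\<^sup>2"] assms(1) by simp

text \<open>The resolvent identity \<open>T - T\<^sup>* = (z - cnj z) Q\<^sup>* Q\<close>, where \<open>T = P\<^sup>* (K - z S\<^sup>2)\<^sup>-\<^sup>1 P\<close> and
  \<open>Q = S (K - z S\<^sup>2)\<^sup>-\<^sup>1 P\<close>, is read off on the diagonal.\<close>

lemma resolvent_estimate: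
  fixes K S R P :: "complex mat"
  assumes K: "K \<in> carrier_mat m m" "mat_adjoint K = K" and S: "S \<in> carrier_mat m m" "mat_adjoint S = S"
    and R: "R \<in> carrier_mat m m" "(K - z \<cdot>\<^sub>m (S * S)) * R = 1\<^sub>m m"
    and P: "P \<in> carrier_mat m k" and ij: "i < m" "j < k"
  shows "(cmod ((S * R * P) $$ (i, j)))\<^sup>2 * \<bar>Im z\<bar> \<le> \<bar>Im ((mat_adjoint P * R * P) $$ (j, j))\<bar>"
proof -
  note [simp] = carrier_matD[OF K(1)] carrier_matD[OF S(1)] carrier_matD[OF R(1)] carrier_matD[OF P]
  define A where "A = K - z \<cdot>\<^sub>m (S * S)"
  have [simp]: "dim_row A = m" "dim_col A = m"
    by (simp_all add: A_def)
  have A_adj: "mat_adjoint A = K - cnj z \<cdot>\<^sub>m (S * S)"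
    by (simp add: A_def mat_adjoint_diff mat_adjoint_smult mat_adjoint_mult K(2) S(2))
  have AR: "A * R = 1\<^sub>m m"
    using R(2) by (simp add: A_def)
  have RA: "mat_adjoint R * mat_adjoint A = 1\<^sub>m m"
    using arg_cong[OF AR, of mat_adjoint] by (simp add: mat_adjoint_mult)
  \<comment> \<open>The Hermitian part \<open>K\<close> cancels. Sandwiched between
    \<open>mat_adjoint R\<close> and \<open>R\<close>, the right-hand side becomes
    \<open>R - mat_adjoint R\<close>, since both \<open>A * R\<close> and
    \<open>mat_adjoint R * mat_adjoint A\<close> are the identity.\<close>
  have diff: "(z - cnj z) \<cdot>\<^sub>m (S * S) = mat_adjoint A - A"
    unfolding A_adj by (rule eq_matI) (simp_all add: A_def algebra_simps del: index_mult_mat(1))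
  define Q where "Q = S * R * P"
  define T where "T = mat_adjoint P * R * P"
  have QQ: "mat_adjoint Q * Q = mat_adjoint P * (mat_adjoint R * ((S * S) * (R * P)))"
    by (simp add: Q_def mat_adjoint_mult S(2) mat_mult_assoc)
  have "(z - cnj z) \<cdot>\<^sub>m (mat_adjoint Q * Q) =
      mat_adjoint P * (mat_adjoint R * (((z - cnj z) \<cdot>\<^sub>m (S * S)) * (R * P)))"
    unfolding QQ by (simp add: mat_smult_mult)
  also have "\<dots> = mat_adjoint P * ((mat_adjoint R * mat_adjoint A) * (R * P))
      - mat_adjoint P * (mat_adjoint R * ((A * R) * P))"
    unfolding diff by (simp add: mat_dim_algebra)
  also have "\<dots> = T - mat_adjoint T"
    unfolding RA AR by (simp add: T_def mat_adjoint_mult mat_mult_assoc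
        left_mult_one_mat[OF P] left_mult_one_mat[OF mult_carrier_mat[OF R(1) P]])
  finally have "((z - cnj z) \<cdot>\<^sub>m (mat_adjoint Q * Q)) $$ (j, j) = (T - mat_adjoint T) $$ (j, j)"
    by simp
  then have "(z - cnj z) * (mat_adjoint Q * Q) $$ (j, j) = T $$ (j, j) - cnj (T $$ (j, j))"
    using ij by (simp add: Q_def T_def del: index_mult_mat(1))
  then have "Im z * Re ((mat_adjoint Q * Q) $$ (j, j)) = Im (T $$ (j, j))"
    using ij gram_diag[of j Q] by (simp add: complex_eq_iff Q_def)
  then have "\<bar>Im (T $$ (j, j))\<bar> = \<bar>Im z\<bar> * \<bar>Re ((mat_adjoint Q * Q) $$ (j, j))\<bar>"
    by (metis abs_mult)
  moreover have "(cmod (Q $$ (i, j)))\<^sup>2 \<le> \<bar>Re ((mat_adjoint Q * Q) $$ (j, j))\<bar>"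
    using gram_diag_ge[of i Q j] ij by (simp add: Q_def)
  ultimately show ?thesis
    unfolding Q_def T_def by (simp add: mult.commute mult_left_mono)
qed

text \<open>With \<open>P = S\<close> the resolvent estimate bounds the square of each entry by a
  diagonal entry of the same matrix. On the diagonal one power can be divided out, which gives the
  bound there; inserting it once more gives the bound for the other entries.\<close>

lemma resolvent_bound:
  fixes K S R :: "complex mat"
  assumes K: "K \<in> carrier_mat m m" "mat_adjoint K = K" and S: "S \<in> carrier_mat m m" "mat_adjoint S = S"
    and R: "R \<in> carrier_mat m m" "(K - z \<cdot>\<^sub>m (S * S)) * R = 1\<^sub>m m"
    and z: "z \<notin> \<real>" and ij: "i < m" "j < m"
  shows "cmod ((S * R * S) $$ (i, j)) \<le> 1 / \<bar>Im z\<bar>"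
proof -
  define c where "c i j = cmod ((S * R * S) $$ (i, j))" for i j
  have est: "(c i j)\<^sup>2 * \<bar>Im z\<bar> \<le> c j j" if "i < m" "j < m" for i j
  proof -
    have "(c i j)\<^sup>2 * \<bar>Im z\<bar> \<le> \<bar>Im ((S * R * S) $$ (j, j))\<bar>"
      using resolvent_estimate[OF K S R S(1) that] unfolding c_def S(2) .
    also have "\<dots> \<le> c j j"
      unfolding c_def by (rule abs_Im_le_cmod)
    finally show ?thesis .
  qed
  have z: "0 < \<bar>Im z\<bar>"
    using z by (simp add: complex_is_Real_iff)
  have "c j j \<le> 1 / \<bar>Im z\<bar>"
  proof (cases "c j j = 0")
    case False
    then have "0 < c j j"
      by (simp add: c_def)
    then show ?thesis
      using est[OF ij(2) ij(2)] z by (simp add: power2_eq_square field_simps)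
  qed simp
  then have "(c i j)\<^sup>2 * \<bar>Im z\<bar> \<le> 1 / \<bar>Im z\<bar>"
    using est[OF ij] by linarith
  then have "(c i j)\<^sup>2 \<le> 1 / \<bar>Im z\<bar> / \<bar>Im z\<bar>"
    using z by (simp only: pos_le_divide_eq)
  then have "(c i j)\<^sup>2 \<le> (1 / \<bar>Im z\<bar>)\<^sup>2"
    by (simp add: power2_eq_square)
  then show ?thesis
    unfolding c_def by (rule power2_le_imp_le) simp
qed

text \<open>Inserting \<open>S * S * Wi = 1\<close> or \<open>Wi * (S * S) = 1\<close> rewrites the
  products that arise on expansion: \<open>W12 * Ai * S = X' * R\<close>,
  \<open>W12 * Ai * H21 = X' * Y\<close>, \<open>H12 * Ai * W21 = Z * X\<close> and
  \<open>W12 * Ai * W21 = X' * (R * X)\<close>. For Hermitian data \<open>X'\<close> is the adjoint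
  of \<open>X\<close>.\<close>

lemma block_identities:
  fixes H11 H12 H21 W11 W12 W21 S Wi Ai :: "complex mat"
  assumes carriers: "H11 \<in> carrier_mat k k" "H12 \<in> carrier_mat k m" "H21 \<in> carrier_mat m k"
      "W11 \<in> carrier_mat k k" "W12 \<in> carrier_mat k m" "W21 \<in> carrier_mat m k"
      "S \<in> carrier_mat m m" "Wi \<in> carrier_mat m m" "Ai \<in> carrier_mat m m"
    and inv: "S * S * Wi = 1\<^sub>m m" "Wi * (S * S) = 1\<^sub>m m"
  defines "X \<equiv> S * (Wi * W21)" and "X' \<equiv> W12 * Wi * S" and "R \<equiv> S * Ai * S"
    and "Y \<equiv> S * Ai * H21" and "Z \<equiv> H12 * Ai * S"
  shows "(H12 - z \<cdot>\<^sub>m W12) * Ai * S = Z - z \<cdot>\<^sub>m (X' * R)"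
    "(H11 - z \<cdot>\<^sub>m W11) - (H12 - z \<cdot>\<^sub>m W12) * Ai * (H21 - z \<cdot>\<^sub>m W21) =
      (H11 - H12 * Ai * H21) - z \<cdot>\<^sub>m W11 + z \<cdot>\<^sub>m (X' * Y) + z \<cdot>\<^sub>m (Z * X) - (z * z) \<cdot>\<^sub>m (X' * (R * X))"
    "S * (Wi * W21 - Ai * (H21 - z \<cdot>\<^sub>m W21)) = X - Y + z \<cdot>\<^sub>m (R * X)"
    "W11 - W12 * Wi * W21 = W11 - X' * X"
proof -
  note [simp] = carriers[THEN carrier_matD(1)] carriers[THEN carrier_matD(2)]
  have cancel1: "Wi * (S * (S * M)) = M" if "M \<in> carrier_mat m l" for M l
    using inv(2) left_mult_one_mat[OF that] carrier_matD[OF that] by (simp flip: mat_mult_assoc)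
  have cancel2: "S * (S * (Wi * M)) = M" if "M \<in> carrier_mat m l" for M l
    using inv(1) left_mult_one_mat[OF that] carrier_matD[OF that] by (simp flip: mat_mult_assoc)
  have X'R: "X' * R = W12 * (Ai * S)"
    using cancel1[of "Ai * S" m] by (simp add: X'_def R_def mat_mult_assoc carrier_matI)
  have RX: "R * X = S * (Ai * W21)"
    using cancel2[of W21 k] by (simp add: X_def R_def mat_mult_assoc carrier_matI)
  have X'Y: "X' * Y = W12 * (Ai * H21)"
    using cancel1[of "Ai * H21" k] by (simp add: X'_def Y_def mat_mult_assoc carrier_matI)
  have ZX: "Z * X = H12 * (Ai * W21)"
    using cancel2[of W21 k] by (simp add: X_def Z_def mat_mult_assoc carrier_matI)
  have X'RX: "X' * (R * X) = W12 * (Ai * W21)"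
    unfolding RX using cancel1[of "Ai * W21" k] by (simp add: X'_def mat_mult_assoc carrier_matI)
  have X'X: "X' * X = W12 * (Wi * W21)"
    using cancel1[of "Wi * W21" k] by (simp add: X'_def X_def mat_mult_assoc carrier_matI)
  show "(H12 - z \<cdot>\<^sub>m W12) * Ai * S = Z - z \<cdot>\<^sub>m (X' * R)"
    unfolding X'R by (simp add: Z_def mat_dim_algebra)
  show "(H11 - z \<cdot>\<^sub>m W11) - (H12 - z \<cdot>\<^sub>m W12) * Ai * (H21 - z \<cdot>\<^sub>m W21) =
      (H11 - H12 * Ai * H21) - z \<cdot>\<^sub>m W11 + z \<cdot>\<^sub>m (X' * Y) + z \<cdot>\<^sub>m (Z * X) - (z * z) \<cdot>\<^sub>m (X' * (R * X))"
    unfolding X'Y ZX X'RX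
    by (rule eq_matI) (simp_all add: mat_dim_algebra algebra_simps del: index_mult_mat(1))
  show "S * (Wi * W21 - Ai * (H21 - z \<cdot>\<^sub>m W21)) = X - Y + z \<cdot>\<^sub>m (R * X)"
    unfolding RX
    by (rule eq_matI) (simp_all add: X_def Y_def mat_dim_algebra algebra_simps del: index_mult_mat(1))
  show "W11 - W12 * Wi * W21 = W11 - X' * X"
    unfolding X'X by (simp add: mat_mult_assoc)
qed

text \<open>The bound on \<open>X\<close> is the diagonal of the positive Schur complement
  \<open>W11 - mat_adjoint X * X\<close>. The bound on \<open>S * Ai * H21\<close> is the resolvent
  estimate with \<open>P = H21\<close>, in which the imaginary part on the right is that of
  \<open>B\<close> up to sign.\<close>

lemma block_estimates:
  fixes H11 H12 H21 H22 W11 W12 W21 S :: "complex mat"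
  assumes carriers: "H11 \<in> carrier_mat k k" "H12 \<in> carrier_mat k m" "H21 \<in> carrier_mat m k"
      "H22 \<in> carrier_mat m m" "W11 \<in> carrier_mat k k" "W12 \<in> carrier_mat k m"
      "W21 \<in> carrier_mat m k" "S \<in> carrier_mat m m"
    and herm: "mat_adjoint H11 = H11" "H12 = mat_adjoint H21" "mat_adjoint H22 = H22"
      "W12 = mat_adjoint W21" "mat_adjoint S = S"
    and det: "Determinant.det (S * S) \<noteq> 0"
    and schur: "psd (W11 - W12 * mat_inv (S * S) * W21)"
    and z: "z \<notin> \<real>"
  defines "Wi \<equiv> mat_inv (S * S)" and "Ai \<equiv> mat_inv (H22 - z \<cdot>\<^sub>m (S * S))"
  defines "X \<equiv> S * (Wi * W21)" and "B \<equiv> H11 - H12 * Ai * H21"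
  shows "mat_adjoint X = W12 * Wi * S"
    "i < m \<Longrightarrow> j < k \<Longrightarrow> (cmod (X $$ (i, j)))\<^sup>2 \<le> cmod (W11 $$ (j, j))"
    "i < m \<Longrightarrow> j < m \<Longrightarrow> cmod ((S * Ai * S) $$ (i, j)) \<le> 1 / \<bar>Im z\<bar>"
    "i < m \<Longrightarrow> j < k \<Longrightarrow> (cmod ((S * Ai * H21) $$ (i, j)))\<^sup>2 \<le> 1 / \<bar>Im z\<bar> * cmod (B $$ (j, j))"
    "i < k \<Longrightarrow> j < m \<Longrightarrow> (cmod ((H12 * Ai * S) $$ (i, j)))\<^sup>2 \<le> 1 / \<bar>Im z\<bar> * cmod (B $$ (i, i))"
proof -
  have SS: "S * S \<in> carrier_mat m m"
    by (rule mult_carrier_mat[OF carriers(8) carriers(8)])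
  have A: "H22 - z \<cdot>\<^sub>m (S * S) \<in> carrier_mat m m"
    by (rule minus_carrier_mat[OF smult_carrier_mat[OF SS]])
  have det_A: "Determinant.det (H22 - z \<cdot>\<^sub>m (S * S)) \<noteq> 0"
    by (rule pencil_det_nonzero[OF carriers(4) herm(3) carriers(8) herm(5) det z])
  have Wi: "Wi \<in> carrier_mat m m" and Ai: "Ai \<in> carrier_mat m m"
    by (simp_all only: Wi_def Ai_def mat_inv_carrier[OF SS] mat_inv_carrier[OF A])
  have inv: "(S * S) * Wi = 1\<^sub>m m" "Wi * (S * S) = 1\<^sub>m m" "(H22 - z \<cdot>\<^sub>m (S * S)) * Ai = 1\<^sub>m m"
      "Ai * (H22 - z \<cdot>\<^sub>m (S * S)) = 1\<^sub>m m"
    using mat_inv_mult[OF SS det] mat_inv_mult[OF A det_A] by (simp_all only: Wi_def Ai_def)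
  note [simp] = carriers[THEN carrier_matD(1)] carriers[THEN carrier_matD(2)]
    carrier_matD[OF Wi] carrier_matD[OF Ai]
  have "mat_adjoint Wi = Wi"
    unfolding Wi_def mat_adjoint_inv[OF SS det] by (simp add: mat_adjoint_mult herm(5))
  then show X_adj: "mat_adjoint X = W12 * Wi * S"
    by (simp add: X_def mat_adjoint_mult herm(4,5) mat_mult_assoc)
  have X_dim: "dim_row X = m" "dim_col X = k"
    by (simp_all add: X_def)
  have abs_z: "0 < \<bar>Im z\<bar>"
    using z by (simp add: complex_is_Real_iff)
  show "(cmod (X $$ (i, j)))\<^sup>2 \<le> cmod (W11 $$ (j, j))" if "i < m" "j < k" for i j
  proof -
    have "W11 - W12 * mat_inv (S * S) * W21 = W11 - W12 * Wi * S * X"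
      using block_identities(4)[OF carriers(1-3,5-8) Wi Ai inv(1,2)] by (simp only: Wi_def X_def)
    then have schur_eq: "W11 - W12 * mat_inv (S * S) * W21 = W11 - mat_adjoint X * X"
      by (simp only: X_adj)
    have "W11 - mat_adjoint X * X \<in> carrier_mat k k"
      by (rule carrier_matI) (simp_all add: X_dim)
    from psd_diag[OF this schur[unfolded schur_eq] that(2)]
    have "Re ((mat_adjoint X * X) $$ (j, j)) \<le> Re (W11 $$ (j, j))"
      using that by (simp add: X_dim less_eq_complex_def del: index_mult_mat(1))
    with gram_diag_ge[of i X j] that complex_Re_le_cmod[of "W11 $$ (j, j)"] show ?thesis
      by (simp add: X_dim)
  qed
  show "cmod ((S * Ai * S) $$ (i, j)) \<le> 1 / \<bar>Im z\<bar>" if "i < m" "j < m" for i j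
    by (rule resolvent_bound[OF carriers(4) herm(3) carriers(8) herm(5) Ai inv(3) z that])
  define T where "T = H12 * Ai * H21"
  \<comment> \<open>The diagonal of the Hermitian matrix \<open>H11\<close> is real, so
    \<open>B\<close> and \<open>T\<close> have opposite imaginary parts there.\<close>
  have T: "\<bar>Im (T $$ (j, j))\<bar> \<le> cmod (B $$ (j, j))" if "j < k" for j
  proof -
    have "cnj (H11 $$ (j, j)) = H11 $$ (j, j)"
      using arg_cong[OF herm(1), of "\<lambda>M. M $$ (j, j)"] that by simp
    then have "Im (H11 $$ (j, j)) = 0"
      by (simp add: complex_eq_iff)
    moreover have "B $$ (j, j) = H11 $$ (j, j) - T $$ (j, j)"
      using that by (simp add: B_def T_def del: index_mult_mat(1))
    ultimately show ?thesis
      using abs_Im_le_cmod[of "B $$ (j, j)"] by simp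
  qed
  show "(cmod ((S * Ai * H21) $$ (i, j)))\<^sup>2 \<le> 1 / \<bar>Im z\<bar> * cmod (B $$ (j, j))" if "i < m" "j < k" for i j
  proof -
    have "(cmod ((S * Ai * H21) $$ (i, j)))\<^sup>2 * \<bar>Im z\<bar> \<le> cmod (B $$ (j, j))"
      using resolvent_estimate[OF carriers(4) herm(3) carriers(8) herm(5) Ai inv(3) carriers(3) that]
        T[OF that(2)] unfolding T_def herm(2) by linarith
    then show ?thesis
      using abs_z by (simp add: field_simps)
  qed
  show "(cmod ((H12 * Ai * S) $$ (i, j)))\<^sup>2 \<le> 1 / \<bar>Im z\<bar> * cmod (B $$ (i, i))" if "i < k" "j < m" for i j
  proof -
    \<comment> \<open>The adjoint of \<open>H12 * Ai * S\<close> has the shape of the previous case,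
      with \<open>Ai\<close> replaced by its adjoint. That is the resolvent at \<open>cnj z\<close>,
      whose imaginary part has the same absolute value; rows become columns, whence the index
      \<open>i\<close> on the right.\<close>
    let ?Ai = "mat_adjoint Ai"
    have A_adj: "mat_adjoint (H22 - z \<cdot>\<^sub>m (S * S)) = H22 - cnj z \<cdot>\<^sub>m (S * S)"
      by (simp add: mat_adjoint_diff mat_adjoint_smult mat_adjoint_mult herm(3,5))
    have Ai': "?Ai \<in> carrier_mat m m"
      using Ai by simp
    have inv': "(H22 - cnj z \<cdot>\<^sub>m (S * S)) * ?Ai = 1\<^sub>m m"
      using arg_cong[OF inv(4), of mat_adjoint] by (simp add: mat_adjoint_mult flip: A_adj)
    have "S * ?Ai * H21 = mat_adjoint (H12 * Ai * S)"
      by (simp add: mat_adjoint_mult herm(2,5) mat_mult_assoc)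
    then have e1: "(S * ?Ai * H21) $$ (j, i) = cnj ((H12 * Ai * S) $$ (i, j))"
      using that by (simp del: index_mult_mat(1))
    have "mat_adjoint H21 * ?Ai * H21 = mat_adjoint T"
      by (simp add: T_def mat_adjoint_mult herm(2) mat_mult_assoc)
    then have e2: "(mat_adjoint H21 * ?Ai * H21) $$ (i, i) = cnj (T $$ (i, i))"
      using that by (simp add: T_def del: index_mult_mat(1))
    have "(cmod ((H12 * Ai * S) $$ (i, j)))\<^sup>2 * \<bar>Im z\<bar> \<le> cmod (B $$ (i, i))"
      using resolvent_estimate[OF carriers(4) herm(3) carriers(8) herm(5) Ai' inv' carriers(3) that(2,1)]
        T[OF that(1)] unfolding e1 e2 by simp
    then show ?thesis
      using abs_z by (simp add: field_simps)
  qed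
qed

section \<open>Integrable block products and the equivalence for Hermitian block pencils\<close>

lemma Mats_Lp_loc_2_2:
  "A \<in> Mats m k (Lp_loc 2) UNIV \<Longrightarrow> B \<in> Mats k l (Lp_loc 2) UNIV \<Longrightarrow>
    (\<lambda>t. A t * B t) \<in> Mats m l (Lp_loc 1) UNIV"
  by (rule Mats_mult[where E = "Lp_loc 1", OF ae_space_Lp_loc_1]) (auto intro: Lp_loc_2_mult)

lemma Mats_Lp_loc_infinity_2:
  "A \<in> Mats m k (Lp_loc \<infinity>) UNIV \<Longrightarrow> B \<in> Mats k l (Lp_loc 2) UNIV \<Longrightarrow>
    (\<lambda>t. A t * B t) \<in> Mats m l (Lp_loc 2) UNIV"
  by (rule Mats_mult[where E = "Lp_loc 2", OF ae_space_Lp_loc_2 _ _ Lp_loc_infinity_mult])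

lemma Mats_Lp_loc_2_infinity:
  "A \<in> Mats m k (Lp_loc 2) UNIV \<Longrightarrow> B \<in> Mats k l (Lp_loc \<infinity>) UNIV \<Longrightarrow>
    (\<lambda>t. A t * B t) \<in> Mats m l (Lp_loc 2) UNIV"
  by (rule Mats_mult[where E = "Lp_loc 2", OF ae_space_Lp_loc_2], assumption, assumption,
      subst mult.commute, rule Lp_loc_infinity_mult)

lemma Mats_AE_iff:
  assumes F: "ae_space (F UNIV)" and "\<And>t. A t \<in> carrier_mat m k" "\<And>t. B t \<in> carrier_mat m k"
    and "AE t in lebesgue. A t = B t"
  shows "A \<in> Mats m k F UNIV \<longleftrightarrow> B \<in> Mats m k F UNIV"
proof -
  have "AE t in lebesgue. B t = A t"
    using assms(4) by eventually_elim simp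
  then show ?thesis
    using Mats_AE_cong[where F = F, OF F, of A m k B] Mats_AE_cong[where F = F, OF F, of B m k A] assms(2-4) by blast
qed

text \<open>A term already known to lie in the space may be dropped from a sum. With the two
  companions for differences, this allows the expanded Schur complement to be stripped term by term
  in a chain of equivalences.\<close>

lemma Mats_add_iff_left:
  assumes F: "ae_space (F UNIV)" and B: "B \<in> Mats m k F UNIV" and A: "\<And>t. A t \<in> carrier_mat m k"
  shows "(\<lambda>t. A t + B t) \<in> Mats m k F UNIV \<longleftrightarrow> A \<in> Mats m k F UNIV"
proof
  have "A t + B t - B t = A t" for t
    using A[of t] Mats_UNIV_D(1)[OF B, of t] by (intro eq_matI) auto
  then show "A \<in> Mats m k F UNIV" if "(\<lambda>t. A t + B t) \<in> Mats m k F UNIV"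
    using Mats_diff[where F = F, OF F that B] by simp
qed (rule Mats_add[where F = F, OF F _ B])

lemma Mats_diff_iff_left:
  assumes F: "ae_space (F UNIV)" and B: "B \<in> Mats m k F UNIV" and A: "\<And>t. A t \<in> carrier_mat m k"
  shows "(\<lambda>t. A t - B t) \<in> Mats m k F UNIV \<longleftrightarrow> A \<in> Mats m k F UNIV"
proof
  have "A t - B t + B t = A t" for t
    using A[of t] Mats_UNIV_D(1)[OF B, of t] by (intro eq_matI) auto
  then show "A \<in> Mats m k F UNIV" if "(\<lambda>t. A t - B t) \<in> Mats m k F UNIV"
    using Mats_add[where F = F, OF F that B] by simp
qed (rule Mats_diff[where F = F, OF F _ B])

lemma Mats_diff_iff_right:
  assumes F: "ae_space (F UNIV)" and A: "A \<in> Mats m k F UNIV" and B: "\<And>t. B t \<in> carrier_mat m k"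
  shows "(\<lambda>t. A t - B t) \<in> Mats m k F UNIV \<longleftrightarrow> B \<in> Mats m k F UNIV"
proof
  have "A t - (A t - B t) = B t" for t
    using B[of t] Mats_UNIV_D(1)[OF A, of t] by (intro eq_matI) auto
  then show "B \<in> Mats m k F UNIV" if "(\<lambda>t. A t - B t) \<in> Mats m k F UNIV"
    using Mats_diff[where F = F, OF F A that] by simp
qed (rule Mats_diff[where F = F, OF F A])

text \<open>The situation after the change of basis, with \<open>k\<close> and \<open>m\<close> in
  the roles of \<open>n\<^sub>1\<close> and \<open>n\<^sub>2\<close>. Positivity of \<open>W\<close>
  appears through \<open>W22\<close> and its Schur complement, the form in which the estimates
  consume it.\<close>

locale hermitian_pencil_blocks =
  fixes k m :: nat and H11 H12 H21 H22 W11 W12 W21 W22 :: "real \<Rightarrow> complex mat" and z :: complex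
  assumes meas: "H11 \<in> Mats k k Meas UNIV" "H12 \<in> Mats k m Meas UNIV" "H21 \<in> Mats m k Meas UNIV"
      "H22 \<in> Mats m m Meas UNIV" "W11 \<in> Mats k k Meas UNIV" "W12 \<in> Mats k m Meas UNIV"
      "W21 \<in> Mats m k Meas UNIV" "W22 \<in> Mats m m Meas UNIV"
    and herm: "AE t in lebesgue. mat_adjoint (H11 t) = H11 t \<and> H12 t = mat_adjoint (H21 t) \<and>
      mat_adjoint (H22 t) = H22 t \<and> W12 t = mat_adjoint (W21 t)"
    and pos: "AE t in lebesgue. psd (W22 t) \<and> Determinant.det (W22 t) \<noteq> 0 \<and>
      psd (W11 t - W12 t * mat_inv (W22 t) * W21 t)"
    and z: "z \<notin> \<real>"
begin

definition "Wi t = mat_inv (W22 t)"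
definition "Ai t = mat_inv (H22 t - z \<cdot>\<^sub>m W22 t)"
definition "S t = psd_sqrt (W22 t)"
definition "X t = S t * (Wi t * W21 t)"
definition "R t = S t * Ai t * S t"
definition "Y t = S t * Ai t * H21 t"
definition "Z t = H12 t * Ai t * S t"
definition "B t = H11 t - H12 t * Ai t * H21 t"

lemma Meas_blocks:
  "Wi \<in> Mats m m Meas UNIV" "Ai \<in> Mats m m Meas UNIV" "S \<in> Mats m m Meas UNIV"
  "X \<in> Mats m k Meas UNIV" "R \<in> Mats m m Meas UNIV" "Y \<in> Mats m k Meas UNIV"
  "Z \<in> Mats k m Meas UNIV"
proof -
  show Wi: "Wi \<in> Mats m m Meas UNIV"
    unfolding Wi_def by (rule Mats_Meas_inv[OF meas(8)])
  show Ai: "Ai \<in> Mats m m Meas UNIV"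
    unfolding Ai_def
    by (rule Mats_Meas_inv[OF Mats_diff[where F = Meas, OF ae_space_Meas meas(4)
          Mats_smult[where F = Meas, OF ae_space_Meas meas(8)]]])
  have "AE t in lebesgue. psd (W22 t)"
    using pos by eventually_elim simp
  from Mats_Meas_psd_sqrt[OF meas(8) this] show S: "S \<in> Mats m m Meas UNIV"
    by (simp add: S_def[abs_def])
  show "X \<in> Mats m k Meas UNIV"
    unfolding X_def by (rule Mats_Meas_mult[OF S Mats_Meas_mult[OF Wi meas(7)]])
  show "R \<in> Mats m m Meas UNIV"
    unfolding R_def by (rule Mats_Meas_mult[OF Mats_Meas_mult[OF S Ai] S])
  show "Y \<in> Mats m k Meas UNIV"
    unfolding Y_def by (rule Mats_Meas_mult[OF Mats_Meas_mult[OF S Ai] meas(3)])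
  show "Z \<in> Mats k m Meas UNIV"
    unfolding Z_def by (rule Mats_Meas_mult[OF Mats_Meas_mult[OF meas(2) Ai] S])
qed

lemmas carriers = meas(1-3,5-7)[THEN Mats_UNIV_D(1)] Meas_blocks(3,1,2)[THEN Mats_UNIV_D(1)]

text \<open>All pointwise facts are gathered under a single almost-everywhere quantifier. The factor
  1 in the bound for \<open>X\<close> matches the constant expected by
  \<open>Lp_loc_2_dominated\<close>.\<close>

lemma AE_estimates:
  "AE t in lebesgue. S t * S t = W22 t \<and> S t * S t * Wi t = 1\<^sub>m m \<and> Wi t * (S t * S t) = 1\<^sub>m m \<and>
    Determinant.det (H22 t - z \<cdot>\<^sub>m W22 t) \<noteq> 0 \<and>
    mat_adjoint (X t) = W12 t * Wi t * S t \<and>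
    (\<forall>i<m. \<forall>j<k. (cmod (X t $$ (i, j)))\<^sup>2 \<le> 1 * cmod (W11 t $$ (j, j))) \<and>
    (\<forall>i<m. \<forall>j<m. cmod (R t $$ (i, j)) \<le> 1 / \<bar>Im z\<bar>) \<and>
    (\<forall>i<m. \<forall>j<k. (cmod (Y t $$ (i, j)))\<^sup>2 \<le> 1 / \<bar>Im z\<bar> * cmod (B t $$ (j, j))) \<and>
    (\<forall>i<k. \<forall>j<m. (cmod (Z t $$ (i, j)))\<^sup>2 \<le> 1 / \<bar>Im z\<bar> * cmod (B t $$ (i, i)))"
  using herm pos
proof eventually_elim
  case (elim t)
  have W22: "W22 t \<in> carrier_mat m m"
    by (rule Mats_UNIV_D(1)[OF meas(8)])
  have S: "S t \<in> carrier_mat m m" "mat_adjoint (S t) = S t" "S t * S t = W22 t"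
    using psd_sqrt[OF W22] elim unfolding S_def by (simp_all add: psd_def)
  have det: "Determinant.det (S t * S t) \<noteq> 0"
    and schur: "psd (W11 t - W12 t * mat_inv (S t * S t) * W21 t)"
    using elim unfolding S(3) by simp_all
  have herm: "mat_adjoint (H11 t) = H11 t" "H12 t = mat_adjoint (H21 t)"
      "mat_adjoint (H22 t) = H22 t" "W12 t = mat_adjoint (W21 t)"
    using elim by simp_all
  note est = block_estimates[OF carriers(1-3)[of t] Mats_UNIV_D(1)[OF meas(4), of t]
      carriers(4-6)[of t] S(1) herm S(2) det schur z, unfolded S(3), folded Wi_def Ai_def,
      folded X_def R_def Y_def Z_def B_def]
  have "Determinant.det (H22 t - z \<cdot>\<^sub>m W22 t) \<noteq> 0"
    using pencil_det_nonzero[OF Mats_UNIV_D(1)[OF meas(4)] herm(3) S(1,2) det z] unfolding S(3) .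
  moreover have "S t * S t * Wi t = 1\<^sub>m m" "Wi t * (S t * S t) = 1\<^sub>m m"
    using mat_inv_mult[OF W22] elim unfolding S(3) Wi_def by simp_all
  ultimately show ?case
    using est S(3) by (intro conjI allI impI) simp_all
qed

lemma X_Lp:
  assumes "W11 \<in> Mats k k (Lp_loc 1) UNIV"
  shows "X \<in> Mats m k (Lp_loc 2) UNIV"
proof (rule Mats_UNIV_I)
  fix i j assume ij: "i < m" "j < k"
  show "(\<lambda>t. X t $$ (i, j)) \<in> Lp_loc 2 UNIV"
  proof (rule Lp_loc_2_dominated[OF _ Mats_UNIV_D(4)[OF assms ij(2) ij(2)]])
    show "AE t in lebesgue. (cmod (X t $$ (i, j)))\<^sup>2 \<le> 1 * cmod (W11 t $$ (j, j))"
      using AE_estimates by eventually_elim (use ij in blast)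
  qed (use Mats_UNIV_D(4)[OF Meas_blocks(4) ij] in simp)
qed (rule Mats_UNIV_D(1)[OF Meas_blocks(4)])

lemma R_Lp: "R \<in> Mats m m (Lp_loc \<infinity>) UNIV"
proof (rule Mats_UNIV_I)
  fix i j assume ij: "i < m" "j < m"
  have "AE t in lebesgue. cmod (R t $$ (i, j)) \<le> 1 / \<bar>Im z\<bar>"
    using AE_estimates by eventually_elim (use ij in blast)
  then have "\<exists>C. AE t in lebesgue_on {a..b}. cmod (R t $$ (i, j)) \<le> C" for a b
    using AE_lebesgue_on[of _ "{a..b}"] by auto
  then show "(\<lambda>t. R t $$ (i, j)) \<in> Lp_loc \<infinity> UNIV"
    unfolding Lp_loc_infinity_iff using Mats_UNIV_D(4)[OF Meas_blocks(5) ij] by simp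
qed (rule Mats_UNIV_D(1)[OF Meas_blocks(5)])

lemma YZ_Lp:
  assumes "B \<in> Mats k k (Lp_loc 1) UNIV"
  shows "Y \<in> Mats m k (Lp_loc 2) UNIV" "Z \<in> Mats k m (Lp_loc 2) UNIV"
proof -
  show "Y \<in> Mats m k (Lp_loc 2) UNIV"
  proof (rule Mats_UNIV_I)
    fix i j assume ij: "i < m" "j < k"
    show "(\<lambda>t. Y t $$ (i, j)) \<in> Lp_loc 2 UNIV"
    proof (rule Lp_loc_2_dominated[OF _ Mats_UNIV_D(4)[OF assms ij(2) ij(2)]])
      show "AE t in lebesgue. (cmod (Y t $$ (i, j)))\<^sup>2 \<le> 1 / \<bar>Im z\<bar> * cmod (B t $$ (j, j))"
        using AE_estimates by eventually_elim (use ij in blast)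
    qed (use Mats_UNIV_D(4)[OF Meas_blocks(6) ij] in simp)
  qed (rule Mats_UNIV_D(1)[OF Meas_blocks(6)])
  show "Z \<in> Mats k m (Lp_loc 2) UNIV"
  proof (rule Mats_UNIV_I)
    fix i j assume ij: "i < k" "j < m"
    show "(\<lambda>t. Z t $$ (i, j)) \<in> Lp_loc 2 UNIV"
    proof (rule Lp_loc_2_dominated[OF _ Mats_UNIV_D(4)[OF assms ij(1) ij(1)]])
      show "AE t in lebesgue. (cmod (Z t $$ (i, j)))\<^sup>2 \<le> 1 / \<bar>Im z\<bar> * cmod (B t $$ (i, i))"
        using AE_estimates by eventually_elim (use ij in blast)
    qed (use Mats_UNIV_D(4)[OF Meas_blocks(7) ij] in simp)
  qed (rule Mats_UNIV_D(1)[OF Meas_blocks(7)])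
qed

lemma AE_identities:
  "AE t in lebesgue. (H12 t - z \<cdot>\<^sub>m W12 t) * Ai t * S t = Z t - z \<cdot>\<^sub>m (W12 t * Wi t * S t * R t)"
  "AE t in lebesgue. (H11 t - z \<cdot>\<^sub>m W11 t) - (H12 t - z \<cdot>\<^sub>m W12 t) * Ai t * (H21 t - z \<cdot>\<^sub>m W21 t) =
    B t - z \<cdot>\<^sub>m W11 t + z \<cdot>\<^sub>m (W12 t * Wi t * S t * Y t) + z \<cdot>\<^sub>m (Z t * X t)
    - (z * z) \<cdot>\<^sub>m (W12 t * Wi t * S t * (R t * X t))"
  "AE t in lebesgue. S t * (Wi t * W21 t - Ai t * (H21 t - z \<cdot>\<^sub>m W21 t)) = X t - Y t + z \<cdot>\<^sub>m (R t * X t)"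
  "AE t in lebesgue. W11 t - W12 t * Wi t * W21 t = W11 t - W12 t * Wi t * S t * X t"
proof -
  have inv: "AE t in lebesgue. S t * S t * Wi t = 1\<^sub>m m \<and> Wi t * (S t * S t) = 1\<^sub>m m"
    using AE_estimates by eventually_elim blast
  show "AE t in lebesgue. (H12 t - z \<cdot>\<^sub>m W12 t) * Ai t * S t = Z t - z \<cdot>\<^sub>m (W12 t * Wi t * S t * R t)"
    unfolding X_def R_def Y_def Z_def B_def using inv
    by eventually_elim (elim conjE, rule block_identities(1)[OF carriers(1-9)])
  show "AE t in lebesgue. (H11 t - z \<cdot>\<^sub>m W11 t) - (H12 t - z \<cdot>\<^sub>m W12 t) * Ai t * (H21 t - z \<cdot>\<^sub>m W21 t) =
    B t - z \<cdot>\<^sub>m W11 t + z \<cdot>\<^sub>m (W12 t * Wi t * S t * Y t) + z \<cdot>\<^sub>m (Z t * X t)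
    - (z * z) \<cdot>\<^sub>m (W12 t * Wi t * S t * (R t * X t))"
    unfolding X_def R_def Y_def Z_def B_def using inv
    by eventually_elim (elim conjE, rule block_identities(2)[OF carriers(1-9)])
  show "AE t in lebesgue. S t * (Wi t * W21 t - Ai t * (H21 t - z \<cdot>\<^sub>m W21 t)) = X t - Y t + z \<cdot>\<^sub>m (R t * X t)"
    unfolding X_def R_def Y_def Z_def B_def using inv
    by eventually_elim (elim conjE, rule block_identities(3)[OF carriers(1-9)])
  show "AE t in lebesgue. W11 t - W12 t * Wi t * W21 t = W11 t - W12 t * Wi t * S t * X t"
    unfolding X_def R_def Y_def Z_def B_def using inv
    by eventually_elim (elim conjE, rule block_identities(4)[OF carriers(1-9)])
qed

text \<open>Since \<open>W11\<close> occurs on both sides, it may be taken locally integrable, and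
  then \<open>X\<close>, its adjoint and their products with \<open>R\<close> are square integrable.
  Removing such terms reduces the two off-diagonal conditions to \<open>Z\<close> and
  \<open>Y\<close>. The remaining clauses of \<open>local_index1\<close>, namely invertibility,
  measurability and boundedness, come from \<open>AE_estimates\<close>, \<open>Meas_blocks\<close>
  and \<open>R_Lp\<close>.\<close>

theorem local_index1_blocks_iff:
  "(\<lambda>t. (H12 t - z \<cdot>\<^sub>m W12 t) * Ai t * S t) \<in> Mats k m (Lp_loc 2) UNIV \<and>
   (\<lambda>t. (H11 t - z \<cdot>\<^sub>m W11 t) - (H12 t - z \<cdot>\<^sub>m W12 t) * Ai t * (H21 t - z \<cdot>\<^sub>m W21 t))
     \<in> Mats k k (Lp_loc 1) UNIV \<and>
   W11 \<in> Mats k k (Lp_loc 1) UNIV \<and>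
   (\<lambda>t. S t * (Wi t * W21 t - Ai t * (H21 t - z \<cdot>\<^sub>m W21 t))) \<in> Mats m k (Lp_loc 2) UNIV \<and>
   (\<lambda>t. W11 t - W12 t * Wi t * W21 t) \<in> Mats k k (Lp_loc 1) UNIV \<longleftrightarrow>
   W11 \<in> Mats k k (Lp_loc 1) UNIV \<and> B \<in> Mats k k (Lp_loc 1) UNIV"
proof (cases "W11 \<in> Mats k k (Lp_loc 1) UNIV")
  case True
  note L1 = ae_space_Lp_loc_1 and L2 = ae_space_Lp_loc_2
  let ?X' = "\<lambda>t. W12 t * Wi t * S t"
  have X'_Meas: "?X' \<in> Mats k m Meas UNIV"
    by (rule Mats_Meas_mult[OF Mats_Meas_mult[OF meas(6) Meas_blocks(1)] Meas_blocks(3)])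
  note car = carriers[THEN carrier_matD(1)] carriers[THEN carrier_matD(2)]
    Meas_blocks(4-7)[THEN Mats_UNIV_D(2)] Meas_blocks(4-7)[THEN Mats_UNIV_D(3)]
  have B_car: "B t \<in> carrier_mat k k" for t
    by (rule carrier_matI) (simp_all add: B_def car)
  note car = car carrier_matD[OF B_car]
  note X = X_Lp[OF True]
  have X': "?X' \<in> Mats k m (Lp_loc 2) UNIV"
  proof (rule Mats_AE_cong[where F = "Lp_loc 2", OF L2 _ Mats_UNIV_D(1)[OF X'_Meas]])
    show "(\<lambda>t. mat_adjoint (X t)) \<in> Mats k m (Lp_loc 2) UNIV"
      by (rule Mats_adjoint[where F = "Lp_loc 2", OF X Lp_loc_2_cnj])
    show "AE t in lebesgue. mat_adjoint (X t) = W12 t * Wi t * S t"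
      using AE_estimates by eventually_elim blast
  qed
  have RX: "(\<lambda>t. R t * X t) \<in> Mats m k (Lp_loc 2) UNIV"
    by (rule Mats_Lp_loc_infinity_2[OF R_Lp X])
  have X'R: "(\<lambda>t. ?X' t * R t) \<in> Mats k m (Lp_loc 2) UNIV"
    by (rule Mats_Lp_loc_2_infinity[OF X' R_Lp])
  have C1: "(\<lambda>t. (H12 t - z \<cdot>\<^sub>m W12 t) * Ai t * S t) \<in> Mats k m (Lp_loc 2) UNIV \<longleftrightarrow>
      Z \<in> Mats k m (Lp_loc 2) UNIV" (is "?L \<longleftrightarrow> _")
  proof -
    have "?L \<longleftrightarrow> (\<lambda>t. Z t - z \<cdot>\<^sub>m (?X' t * R t)) \<in> Mats k m (Lp_loc 2) UNIV"
      by (rule Mats_AE_iff[where F = "Lp_loc 2", OF L2 _ _ AE_identities(1)];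
          rule carrier_matI; simp add: car)
    also have "\<dots> \<longleftrightarrow> Z \<in> Mats k m (Lp_loc 2) UNIV"
      by (rule Mats_diff_iff_left[where F = "Lp_loc 2", OF L2
            Mats_smult[where F = "Lp_loc 2", OF L2 X'R] Mats_UNIV_D(1)[OF Meas_blocks(7)]])
    finally show ?thesis .
  qed
  have C5: "(\<lambda>t. S t * (Wi t * W21 t - Ai t * (H21 t - z \<cdot>\<^sub>m W21 t))) \<in> Mats m k (Lp_loc 2) UNIV \<longleftrightarrow>
      Y \<in> Mats m k (Lp_loc 2) UNIV" (is "?L \<longleftrightarrow> _")
  proof -
    have "?L \<longleftrightarrow> (\<lambda>t. X t - Y t + z \<cdot>\<^sub>m (R t * X t)) \<in> Mats m k (Lp_loc 2) UNIV"
      by (rule Mats_AE_iff[where F = "Lp_loc 2", OF L2 _ _ AE_identities(3)];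
          rule carrier_matI; simp add: car)
    also have "\<dots> \<longleftrightarrow> (\<lambda>t. X t - Y t) \<in> Mats m k (Lp_loc 2) UNIV"
      by (rule Mats_add_iff_left[where F = "Lp_loc 2", OF L2
            Mats_smult[where F = "Lp_loc 2", OF L2 RX]]; rule carrier_matI; simp add: car)
    also have "\<dots> \<longleftrightarrow> Y \<in> Mats m k (Lp_loc 2) UNIV"
      by (rule Mats_diff_iff_right[where F = "Lp_loc 2", OF L2 X Mats_UNIV_D(1)[OF Meas_blocks(6)]])
    finally show ?thesis .
  qed
  have C6: "(\<lambda>t. W11 t - W12 t * Wi t * W21 t) \<in> Mats k k (Lp_loc 1) UNIV" (is ?L)
  proof -
    have "?L \<longleftrightarrow> (\<lambda>t. W11 t - ?X' t * X t) \<in> Mats k k (Lp_loc 1) UNIV"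
      by (rule Mats_AE_iff[where F = "Lp_loc 1", OF L1 _ _ AE_identities(4)];
          rule carrier_matI; simp add: car)
    then show ?thesis
      using Mats_diff[where F = "Lp_loc 1", OF L1 True Mats_Lp_loc_2_2[OF X' X]] by blast
  qed
  \<comment> \<open>The terms \<open>?X' t * Y t\<close> and \<open>Z t * X t\<close> can be removed
    only when \<open>Y\<close> and \<open>Z\<close> are square integrable. \<open>C1\<close> and
    \<open>C5\<close> supply this in one direction, \<open>YZ_Lp\<close> in the other.\<close>
  have C2: "(\<lambda>t. (H11 t - z \<cdot>\<^sub>m W11 t) - (H12 t - z \<cdot>\<^sub>m W12 t) * Ai t * (H21 t - z \<cdot>\<^sub>m W21 t))
      \<in> Mats k k (Lp_loc 1) UNIV \<longleftrightarrow> B \<in> Mats k k (Lp_loc 1) UNIV" (is "?L \<longleftrightarrow> _")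
    if Y: "Y \<in> Mats m k (Lp_loc 2) UNIV" and Z: "Z \<in> Mats k m (Lp_loc 2) UNIV"
  proof -
    have "?L \<longleftrightarrow> (\<lambda>t. B t - z \<cdot>\<^sub>m W11 t + z \<cdot>\<^sub>m (?X' t * Y t) + z \<cdot>\<^sub>m (Z t * X t)
        - (z * z) \<cdot>\<^sub>m (?X' t * (R t * X t))) \<in> Mats k k (Lp_loc 1) UNIV"
      by (rule Mats_AE_iff[where F = "Lp_loc 1", OF L1 _ _ AE_identities(2)];
          rule carrier_matI; simp add: car)
    also have "\<dots> \<longleftrightarrow> (\<lambda>t. B t - z \<cdot>\<^sub>m W11 t + z \<cdot>\<^sub>m (?X' t * Y t) + z \<cdot>\<^sub>m (Z t * X t))
        \<in> Mats k k (Lp_loc 1) UNIV"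
      by (rule Mats_diff_iff_left[where F = "Lp_loc 1", OF L1
            Mats_smult[where F = "Lp_loc 1", OF L1 Mats_Lp_loc_2_2[OF X' RX]]];
          rule carrier_matI; simp add: car)
    also have "\<dots> \<longleftrightarrow> (\<lambda>t. B t - z \<cdot>\<^sub>m W11 t + z \<cdot>\<^sub>m (?X' t * Y t)) \<in> Mats k k (Lp_loc 1) UNIV"
      by (rule Mats_add_iff_left[where F = "Lp_loc 1", OF L1
            Mats_smult[where F = "Lp_loc 1", OF L1 Mats_Lp_loc_2_2[OF Z X]]];
          rule carrier_matI; simp add: car)
    also have "\<dots> \<longleftrightarrow> (\<lambda>t. B t - z \<cdot>\<^sub>m W11 t) \<in> Mats k k (Lp_loc 1) UNIV"
      by (rule Mats_add_iff_left[where F = "Lp_loc 1", OF L1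
            Mats_smult[where F = "Lp_loc 1", OF L1 Mats_Lp_loc_2_2[OF X' Y]]];
          rule carrier_matI; simp add: car)
    also have "\<dots> \<longleftrightarrow> B \<in> Mats k k (Lp_loc 1) UNIV"
      by (rule Mats_diff_iff_left[where F = "Lp_loc 1", OF L1
            Mats_smult[where F = "Lp_loc 1", OF L1 True] B_car])
    finally show ?thesis .
  qed
  show ?thesis
    using True C1 C2 C5 C6 YZ_Lp by blast
qed blast

end

section \<open>The blocks of a unitarily transformed pencil\<close>

text \<open>Cutting \<open>V\<close> into two column blocks \<open>P\<close> and \<open>Q\<close>
  writes each block of the transformed matrix as a product such as
  \<open>mat_adjoint P * A * Q\<close>. Adjoints, pencils, positivity and measurability of blocks
  then follow from matrix algebra, without shifted indices.\<close>

definition left_cols :: "nat \<Rightarrow> complex mat \<Rightarrow> complex mat" where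
  "left_cols r V = Matrix.mat (dim_row V) r (\<lambda>(i, j). V $$ (i, j))"

definition right_cols :: "nat \<Rightarrow> complex mat \<Rightarrow> complex mat" where
  "right_cols r V = Matrix.mat (dim_row V) (dim_col V - r) (\<lambda>(i, j). V $$ (i, j + r))"

lemma left_right_cols_carrier:
  assumes "V \<in> carrier_mat n n"
  shows "left_cols r V \<in> carrier_mat n r" "right_cols r V \<in> carrier_mat n (n - r)"
  using assms by (auto simp: left_cols_def right_cols_def)

lemma mat_inv_unitary:
  assumes "V \<in> carrier_mat n n" "mat_adjoint V * V = 1\<^sub>m n"
  shows "mat_inv V = mat_adjoint V"
  using mat_inv_unique[OF assms(1) mat_adjoint_carrier[OF assms(1)] assms(2)] .

lemma blk_eq_congruence:
  assumes V: "V \<in> carrier_mat n n" "mat_adjoint V * V = 1\<^sub>m n" and r: "r \<le> n" and A: "A \<in> carrier_mat n n"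
  shows "blk11 r V A = mat_adjoint (left_cols r V) * A * left_cols r V"
    "blk12 r V A = mat_adjoint (left_cols r V) * A * right_cols r V"
    "blk21 r V A = mat_adjoint (right_cols r V) * A * left_cols r V"
    "blk22 r V A = mat_adjoint (right_cols r V) * A * right_cols r V"
proof -
  note [simp] = carrier_matD[OF V(1)] carrier_matD[OF A] carrier_matD[OF left_right_cols_carrier(1)[OF V(1)]]
    carrier_matD[OF left_right_cols_carrier(2)[OF V(1)]]
  have left: "left_cols r V $$ (i, j) = V $$ (i, j)" if "i < n" "j < r" for i j
    using that by (simp add: left_cols_def)
  have right: "right_cols r V $$ (i, j) = V $$ (i, j + r)" if "i < n" "j < n - r" for i j
    using that by (simp add: right_cols_def)
  have VA: "(mat_adjoint V * A * V) $$ (i, j) =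
      (\<Sum>l<n. (\<Sum>k<n. cnj (V $$ (k, i)) * A $$ (k, l)) * V $$ (l, j))" if "i < n" "j < n" for i j
    using that by (simp add: index_mult_mat_sum del: index_mult_mat(1))
  have split: "blk11 r V A = Matrix.mat r r (\<lambda>(i, j). (mat_adjoint V * A * V) $$ (i, j))"
    "blk12 r V A = Matrix.mat r (n - r) (\<lambda>(i, j). (mat_adjoint V * A * V) $$ (i, j + r))"
    "blk21 r V A = Matrix.mat (n - r) r (\<lambda>(i, j). (mat_adjoint V * A * V) $$ (i + r, j))"
    "blk22 r V A = Matrix.mat (n - r) (n - r) (\<lambda>(i, j). (mat_adjoint V * A * V) $$ (i + r, j + r))"
    unfolding blk11_def blk12_def blk21_def blk22_def mat_inv_unitary[OF V] split_block_def Let_def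
    by (auto intro!: eq_matI simp del: index_mult_mat(1))
  show "blk11 r V A = mat_adjoint (left_cols r V) * A * left_cols r V"
    "blk12 r V A = mat_adjoint (left_cols r V) * A * right_cols r V"
    "blk21 r V A = mat_adjoint (right_cols r V) * A * left_cols r V"
    "blk22 r V A = mat_adjoint (right_cols r V) * A * right_cols r V"
    unfolding split using r
    by (intro eq_matI;
        simp add: VA index_mult_mat_sum left right del: index_mult_mat(1))+
qed

lemma right_cols_isometry:
  assumes V: "V \<in> carrier_mat n n" "mat_adjoint V * V = 1\<^sub>m n" and r: "r \<le> n"
  shows "mat_adjoint (right_cols r V) * right_cols r V = 1\<^sub>m (n - r)"
proof (rule eq_matI)
  note [simp] = carrier_matD[OF V(1)] carrier_matD[OF left_right_cols_carrier(2)[OF V(1)]]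
  fix i j assume "i < dim_row (1\<^sub>m (n - r) :: complex mat)" "j < dim_col (1\<^sub>m (n - r) :: complex mat)"
  then have ij: "i < n - r" "j < n - r" by auto
  have "(mat_adjoint (right_cols r V) * right_cols r V) $$ (i, j) = (mat_adjoint V * V) $$ (i + r, j + r)"
    using ij r by (simp add: index_mult_mat_sum right_cols_def del: index_mult_mat(1))
  then show "(mat_adjoint (right_cols r V) * right_cols r V) $$ (i, j) = 1\<^sub>m (n - r) $$ (i, j)"
    unfolding V(2) using ij by simp
qed (simp_all add: right_cols_def V carrier_matD[OF V(1)])

text \<open>With \<open>Q = psd_sqrt W * P\<close> the compression is the Gram matrix of
  \<open>Q\<close>. A kernel vector \<open>v\<close> satisfies
  \<open>Q *\<^sub>v v = 0\<^sub>v n\<close>, hence \<open>W\<close> annihilates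
  \<open>P *\<^sub>v v\<close>, and injectivity of \<open>W\<close> and of the isometry
  \<open>P\<close> gives v = 0. This makes \<open>W\<^sub>2\<^sub>2\<close> invertible.\<close>

lemma psd_congruence_det:
  assumes W: "W \<in> carrier_mat n n" "psd W" "Determinant.det W \<noteq> 0"
    and P: "P \<in> carrier_mat n k" "mat_adjoint P * P = 1\<^sub>m k"
  shows "Determinant.det (mat_adjoint P * W * P) \<noteq> 0"
proof
  note S = psd_sqrt[OF W(1,2)]
  define Q where "Q = psd_sqrt W * P"
  have Q: "Q \<in> carrier_mat n k"
    unfolding Q_def by (rule mult_carrier_mat[OF S(1) P(1)])
  note [simp] = carrier_matD[OF S(1)] carrier_matD[OF P(1)] carrier_matD[OF W(1)] carrier_matD[OF Q]
  have S_adj: "mat_adjoint (psd_sqrt W) = psd_sqrt W"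
    using S(2) by (simp add: psd_def)
  have "mat_adjoint Q * Q = mat_adjoint P * ((psd_sqrt W * psd_sqrt W) * P)"
    by (simp add: Q_def mat_adjoint_mult S_adj mat_mult_assoc)
  then have QQ: "mat_adjoint P * W * P = mat_adjoint Q * Q"
    by (simp add: S(3) mat_mult_assoc)
  have QQ_car: "mat_adjoint Q * Q \<in> carrier_mat k k"
    by (rule mult_carrier_mat[OF mat_adjoint_carrier[OF Q] Q])
  assume "Determinant.det (mat_adjoint P * W * P) = 0"
  then obtain v where v: "v \<in> carrier_vec k" "v \<noteq> 0\<^sub>v k" "(mat_adjoint Q * Q) *\<^sub>v v = 0\<^sub>v k"
    unfolding QQ using det_0_iff_vec_prod_zero_field[OF QQ_car] by blast
  have Qv: "Q *\<^sub>v v \<in> carrier_vec n" and Pv: "P *\<^sub>v v \<in> carrier_vec n"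
    using Q P v by auto
  have "mat_adjoint Q *\<^sub>v (Q *\<^sub>v v) = 0\<^sub>v k"
    using v(3) assoc_mult_mat_vec[OF mat_adjoint_carrier[OF Q] Q v(1)] by simp
  then have "(Q *\<^sub>v v) \<bullet>c (Q *\<^sub>v v) = 0"
    using adjoint_cscalar_prod[OF Q v(1) Qv] v(1) by (simp add: scalar_prod_def)
  then have "Q *\<^sub>v v = 0\<^sub>v n"
    using Qv by (simp add: conjugate_square_eq_0_vec)
  then have SPv: "psd_sqrt W *\<^sub>v (P *\<^sub>v v) = 0\<^sub>v n"
    unfolding Q_def using assoc_mult_mat_vec[OF S(1) P(1) v(1)] by simp
  have "psd_sqrt W *\<^sub>v 0\<^sub>v n = 0\<^sub>v n"
    by (rule eq_vecI) (use S(1) in auto)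
  then have "W *\<^sub>v (P *\<^sub>v v) = 0\<^sub>v n"
    using assoc_mult_mat_vec[OF S(1) S(1) Pv] unfolding S(3) SPv by simp
  then have Pv0: "P *\<^sub>v v = 0\<^sub>v n"
    using W(3) det_0_iff_vec_prod_zero_field[OF W(1)] Pv by blast
  have "mat_adjoint P *\<^sub>v 0\<^sub>v n = 0\<^sub>v k"
    by (rule eq_vecI) (use P(1) in auto)
  then have "1\<^sub>m k *\<^sub>v v = 0\<^sub>v k"
    using assoc_mult_mat_vec[OF mat_adjoint_carrier[OF P(1)] P(1) v(1)] unfolding P(2) Pv0 by simp
  then show False
    using v by simp
qed

text \<open>Completing the square: \<open>M\<close> is chosen so that
  \<open>mat_adjoint Q * W * (P - Q * M)\<close> vanishes, and the Schur complement is then the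
  congruence of \<open>W\<close> by \<open>P - Q * M\<close>.\<close>

lemma psd_schur_complement:
  assumes W: "W \<in> carrier_mat n n" "psd W" and P: "P \<in> carrier_mat n k" and Q: "Q \<in> carrier_mat n m"
    and det: "Determinant.det (mat_adjoint Q * W * Q) \<noteq> 0"
  shows "psd (mat_adjoint P * W * P
    - mat_adjoint P * W * Q * mat_inv (mat_adjoint Q * W * Q) * (mat_adjoint Q * W * P))"
proof -
  let ?W22 = "mat_adjoint Q * W * Q"
  have W22: "?W22 \<in> carrier_mat m m"
    by (rule mult_carrier_mat[OF mult_carrier_mat[OF mat_adjoint_carrier[OF Q] W(1)] Q])
  define M where "M = mat_inv ?W22 * (mat_adjoint Q * W * P)"
  note [simp] = carrier_matD[OF W(1)] carrier_matD[OF P] carrier_matD[OF Q]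
    carrier_matD[OF mat_inv_carrier[OF W22]]
  have M [simp]: "dim_row M = m" "dim_col M = k"
    by (simp_all add: M_def)
  have "mat_adjoint Q * W * P \<in> carrier_mat m k"
    by (rule carrier_matI) simp_all
  then have "?W22 * M = mat_adjoint Q * W * P"
    unfolding M_def using mat_inv_mult(1)[OF W22 det] left_mult_one_mat
    by (subst mat_mult_assoc[symmetric]) (simp_all only: dim_mat_adjoint index_mult_mat(2,3) \<open>dim_col Q = m\<close>
        \<open>dim_row (mat_inv ?W22) = m\<close> \<open>dim_col (mat_inv ?W22) = m\<close>)
  then have WM: "mat_adjoint Q * (W * (Q * M)) = mat_adjoint Q * (W * P)"
    by (simp add: mat_mult_assoc)
  have "mat_adjoint (P - Q * M) * W * (P - Q * M) =
      mat_adjoint P * (W * P) - mat_adjoint P * (W * (Q * M))"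
    by (rule eq_matI) (simp_all add: mat_adjoint_diff mat_adjoint_mult mat_dim_algebra WM
        del: index_mult_mat(1))
  moreover have "psd (mat_adjoint (P - Q * M) * W * (P - Q * M))"
    by (rule psd_congruence[OF W, of _ k]) (rule carrier_matI, simp_all)
  ultimately show ?thesis
    by (simp add: M_def mat_mult_assoc)
qed

text \<open>Applied entrywise to norms, where nonnegativity and measurability make Lebesgue and
  gauge integrability coincide, so that \<open>integrable_on_periodic\<close> carries one period to
  every compact interval.\<close>

lemma Mats_Lp_1_periodic:
  assumes d: "0 < d" and A: "A \<in> Mats m k Meas UNIV" and per: "\<And>t. A (t + d) = A t"
  shows "A \<in> Mats m k (Lp 1) {0..d} \<longleftrightarrow> A \<in> Mats m k (Lp_loc 1) UNIV"
proof -
  have key: "f \<in> Lp 1 {0..d} \<longleftrightarrow> f \<in> Lp_loc 1 UNIV"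
    if f: "f \<in> borel_measurable lebesgue" "\<And>t. f (t + d) = f t" for f
  proof -
    have int: "integrable (lebesgue_on {a..b}) (\<lambda>t. norm (f t)) \<longleftrightarrow> (\<lambda>t. norm (f t)) integrable_on {a..b}"
      for a b :: real
    proof -
      have "(\<lambda>t. norm (f t)) \<in> borel_measurable (lebesgue_on {a..b})"
        using f(1) by (intro measurable_restrict_space1) measurable
      then have "integrable (lebesgue_on {a..b}) (\<lambda>t. norm (f t)) \<longleftrightarrow>
          (\<lambda>t. norm (f t)) absolutely_integrable_on {a..b}"
        by (subst absolutely_integrable_measurable_real) auto
      also have "\<dots> \<longleftrightarrow> (\<lambda>t. norm (f t)) integrable_on {a..b}"
        by (rule absolutely_integrable_on_iff_nonneg) simp
      finally show ?thesis .
    qed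
    show ?thesis
      unfolding Lp_1_iff[OF f(1)] Lp_loc_1_iff int
      using integrable_on_periodic[OF d, of "\<lambda>t. norm (f t)"] f by auto
  qed
  have "(\<lambda>t. A t $$ (i, j)) \<in> Lp 1 {0..d} \<longleftrightarrow> (\<lambda>t. A t $$ (i, j)) \<in> Lp_loc 1 UNIV"
    if "i < m" "j < k" for i j
    using key[of "\<lambda>t. A t $$ (i, j)"] Mats_UNIV_D(4)[OF A that] per by simp
  then show ?thesis
    using Mats_UNIV_D(1)[OF A] by (simp add: Mats_def)
qed

lemma blk_pencil:
  assumes V: "V \<in> carrier_mat n n" "mat_adjoint V * V = 1\<^sub>m n" and r: "r \<le> n"
    and A: "A \<in> carrier_mat n n" and B: "B \<in> carrier_mat n n"
  shows "blk11 r V (A - z \<cdot>\<^sub>m B) = blk11 r V A - z \<cdot>\<^sub>m blk11 r V B"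
    "blk12 r V (A - z \<cdot>\<^sub>m B) = blk12 r V A - z \<cdot>\<^sub>m blk12 r V B"
    "blk21 r V (A - z \<cdot>\<^sub>m B) = blk21 r V A - z \<cdot>\<^sub>m blk21 r V B"
    "blk22 r V (A - z \<cdot>\<^sub>m B) = blk22 r V A - z \<cdot>\<^sub>m blk22 r V B"
proof -
  have AB: "A - z \<cdot>\<^sub>m B \<in> carrier_mat n n"
    using A B by (simp add: minus_carrier_mat)
  note [simp] = carrier_matD[OF A] carrier_matD[OF B]
    carrier_matD[OF left_right_cols_carrier(1)[OF V(1)]] carrier_matD[OF left_right_cols_carrier(2)[OF V(1)]]
  show "blk11 r V (A - z \<cdot>\<^sub>m B) = blk11 r V A - z \<cdot>\<^sub>m blk11 r V B"
    "blk12 r V (A - z \<cdot>\<^sub>m B) = blk12 r V A - z \<cdot>\<^sub>m blk12 r V B"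
    "blk21 r V (A - z \<cdot>\<^sub>m B) = blk21 r V A - z \<cdot>\<^sub>m blk21 r V B"
    "blk22 r V (A - z \<cdot>\<^sub>m B) = blk22 r V A - z \<cdot>\<^sub>m blk22 r V B"
    unfolding blk_eq_congruence[OF V r A] blk_eq_congruence[OF V r B] blk_eq_congruence[OF V r AB]
    by (simp_all add: mat_dim_algebra)
qed

lemma Mats_Meas_blk:
  assumes V: "V \<in> carrier_mat n n" "mat_adjoint V * V = 1\<^sub>m n" and r: "r \<le> n"
    and A: "A \<in> Mats n n Meas UNIV"
  shows "(\<lambda>t. blk11 r V (A t)) \<in> Mats r r Meas UNIV"
    "(\<lambda>t. blk12 r V (A t)) \<in> Mats r (n - r) Meas UNIV"
    "(\<lambda>t. blk21 r V (A t)) \<in> Mats (n - r) r Meas UNIV"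
    "(\<lambda>t. blk22 r V (A t)) \<in> Mats (n - r) (n - r) Meas UNIV"
proof -
  have "(\<lambda>t. mat_adjoint P * A t * Q) \<in> Mats k l Meas UNIV"
    if "P \<in> carrier_mat n k" "Q \<in> carrier_mat n l" for P Q k l
    by (intro Mats_Meas_mult[OF Mats_Meas_mult[OF _ A]] Mats_const[where F = Meas, OF ae_space_Meas])
      (use that in auto)
  note this[OF left_right_cols_carrier(1)[OF V(1)] left_right_cols_carrier(1)[OF V(1)]]
    this[OF left_right_cols_carrier(1)[OF V(1)] left_right_cols_carrier(2)[OF V(1)]]
    this[OF left_right_cols_carrier(2)[OF V(1)] left_right_cols_carrier(1)[OF V(1)]]
    this[OF left_right_cols_carrier(2)[OF V(1)] left_right_cols_carrier(2)[OF V(1)]]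
  then show "(\<lambda>t. blk11 r V (A t)) \<in> Mats r r Meas UNIV"
    "(\<lambda>t. blk12 r V (A t)) \<in> Mats r (n - r) Meas UNIV"
    "(\<lambda>t. blk21 r V (A t)) \<in> Mats (n - r) r Meas UNIV"
    "(\<lambda>t. blk22 r V (A t)) \<in> Mats (n - r) (n - r) Meas UNIV"
    by (simp_all only: blk_eq_congruence[OF V r Mats_UNIV_D(1)[OF A]])
qed

section \<open>The index-1 hypotheses for regular and for singular \<open>J\<close>\<close>

lemma local_index1_nonsingular_iff:
  assumes "Determinant.det J \<noteq> 0"
  shows "local_index1 n J V UNIV (\<lambda>t. H t - z \<cdot>\<^sub>m W t) W \<longleftrightarrow>
    (\<lambda>t. H t - z \<cdot>\<^sub>m W t) \<in> Mats n n (Lp_loc 1) UNIV \<and> W \<in> Mats n n (Lp_loc 1) UNIV"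
  using assms by (simp add: local_index1_def)

lemma hermitian_pencil_blocks_blk:
  assumes V: "V \<in> carrier_mat n n" "mat_adjoint V * V = 1\<^sub>m n" and r: "r \<le> n"
    and meas: "H \<in> Mats n n Meas UNIV" "W \<in> Mats n n Meas UNIV"
    and W_pos: "AE t in lebesgue. psd (W t) \<and> Determinant.det (W t) \<noteq> 0"
    and H_herm: "AE t in lebesgue. mat_adjoint (H t) = H t" and z: "z \<notin> \<real>"
  shows "hermitian_pencil_blocks r (n - r)
    (\<lambda>t. blk11 r V (H t)) (\<lambda>t. blk12 r V (H t)) (\<lambda>t. blk21 r V (H t)) (\<lambda>t. blk22 r V (H t))
    (\<lambda>t. blk11 r V (W t)) (\<lambda>t. blk12 r V (W t)) (\<lambda>t. blk21 r V (W t)) (\<lambda>t. blk22 r V (W t)) z"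
proof
  note P = left_right_cols_carrier[OF V(1), of r]
  note [simp] = carrier_matD[OF P(1)] carrier_matD[OF P(2)]
  show "AE t in lebesgue. mat_adjoint (blk11 r V (H t)) = blk11 r V (H t) \<and>
      blk12 r V (H t) = mat_adjoint (blk21 r V (H t)) \<and>
      mat_adjoint (blk22 r V (H t)) = blk22 r V (H t) \<and>
      blk12 r V (W t) = mat_adjoint (blk21 r V (W t))"
    using W_pos H_herm
  proof eventually_elim
    case (elim t)
    have W: "mat_adjoint (W t) = W t"
      using elim by (simp add: psd_def)
    note car = Mats_UNIV_D(1-3)[OF meas(1), of t] Mats_UNIV_D(1-3)[OF meas(2), of t]
    show ?case
      unfolding blk_eq_congruence[OF V r car(1)] blk_eq_congruence[OF V r car(4)]
      by (simp add: mat_adjoint_mult elim(2) W car(2,3,5,6) mat_mult_assoc)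
  qed
  show "AE t in lebesgue. psd (blk22 r V (W t)) \<and> Determinant.det (blk22 r V (W t)) \<noteq> 0 \<and>
      psd (blk11 r V (W t) - blk12 r V (W t) * mat_inv (blk22 r V (W t)) * blk21 r V (W t))"
    using W_pos
  proof eventually_elim
    case (elim t)
    have W: "W t \<in> carrier_mat n n" "psd (W t)" "Determinant.det (W t) \<noteq> 0"
      using elim Mats_UNIV_D(1)[OF meas(2)] by auto
    note det = psd_congruence_det[OF W P(2) right_cols_isometry[OF V r]]
    show ?case
      unfolding blk_eq_congruence[OF V r W(1)]
      using psd_congruence[OF W(1,2) P(2)] det psd_schur_complement[OF W(1,2) P det] by blast
  qed
qed (fact Mats_Meas_blk[OF V r meas(1)] Mats_Meas_blk[OF V r meas(2)] z)+

text \<open>The blocks of \<open>H\<close> and \<open>W\<close> instantiate the abstract pencil.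
  Measurability of the two matrix functions on the right is exported as well, because the passage
  from one period to the line requires it.\<close>

lemma local_index1_singular_iff:
  assumes J: "Determinant.det J = 0" and V: "adapted_unitary n J V"
    and meas: "H \<in> Mats n n Meas UNIV" "W \<in> Mats n n Meas UNIV"
    and W_pos: "AE t in lebesgue. psd (W t) \<and> Determinant.det (W t) \<noteq> 0"
    and H_herm: "AE t in lebesgue. mat_adjoint (H t) = H t" and z: "z \<notin> \<real>"
  defines "r \<equiv> vec_space.rank n J"
  defines "B \<equiv> \<lambda>t. blk11 r V (H t) - blk12 r V (H t) *
    mat_inv (blk22 r V (H t) - z \<cdot>\<^sub>m blk22 r V (W t)) * blk21 r V (H t)"
  shows "local_index1 n J V UNIV (\<lambda>t. H t - z \<cdot>\<^sub>m W t) W \<longleftrightarrow>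
      (\<lambda>t. blk11 r V (W t)) \<in> Mats r r (Lp_loc 1) UNIV \<and> B \<in> Mats r r (Lp_loc 1) UNIV"
    and "(\<lambda>t. blk11 r V (W t)) \<in> Mats r r Meas UNIV" and "B \<in> Mats r r Meas UNIV"
proof -
  have J': "\<not> Determinant.det J \<noteq> 0"
    using J by simp
  have V': "V \<in> carrier_mat n n" "mat_adjoint V * V = 1\<^sub>m n"
    using V by (simp_all add: adapted_unitary_def Let_def)
  obtain J11 where "J11 \<in> carrier_mat r r"
    "mat_inv V * J * V = four_block_mat J11 (0\<^sub>m r (n - r)) (0\<^sub>m (n - r) r) (0\<^sub>m (n - r) (n - r))"
    using V unfolding adapted_unitary_def Let_def r_def by blast
  \<comment> \<open>Subtraction is truncated, so the row count of the adapted block form gives more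
    than a formal identity: \<open>r + (n - r) = n\<close> says exactly that
    \<open>r \<le> n\<close>.\<close>
  from arg_cong[OF this(2), of dim_row] this(1) have "r + (n - r) = n"
    using carrier_matD[OF mat_inv_carrier[OF V'(1)]] by simp
  then have r: "r \<le> n"
    by simp
  interpret P: hermitian_pencil_blocks r "n - r"
    "\<lambda>t. blk11 r V (H t)" "\<lambda>t. blk12 r V (H t)" "\<lambda>t. blk21 r V (H t)" "\<lambda>t. blk22 r V (H t)"
    "\<lambda>t. blk11 r V (W t)" "\<lambda>t. blk12 r V (W t)" "\<lambda>t. blk21 r V (W t)" "\<lambda>t. blk22 r V (W t)" z
    by (rule hermitian_pencil_blocks_blk[OF V' r meas W_pos H_herm z])
  note pencil = blk_pencil[OF V' r Mats_UNIV_D(1)[OF meas(1)] Mats_UNIV_D(1)[OF meas(2)]]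
  have B: "P.B = B"
    by (simp add: fun_eq_iff P.B_def B_def P.Ai_def)
  show "(\<lambda>t. blk11 r V (W t)) \<in> Mats r r Meas UNIV"
    by (rule P.meas(5))
  show "B \<in> Mats r r Meas UNIV"
    unfolding B[symmetric] P.B_def
    by (rule Mats_diff[where F = Meas, OF ae_space_Meas P.meas(1)
          Mats_Meas_mult[OF Mats_Meas_mult[OF P.meas(2) P.Meas_blocks(2)] P.meas(3)]])
  have inv: "AE t in lebesgue. invertible_mat (blk22 r V (H t) - z \<cdot>\<^sub>m blk22 r V (W t))"
    using P.AE_estimates
  proof eventually_elim
    case (elim t)
    have "blk22 r V (H t) - z \<cdot>\<^sub>m blk22 r V (W t) \<in> carrier_mat (n - r) (n - r)"
      by (rule minus_carrier_mat[OF smult_carrier_mat[OF Mats_UNIV_D(1)[OF P.meas(8)]]])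
    then show ?case
      by (rule invertible_mat_det) (use elim in blast)
  qed
  show "local_index1 n J V UNIV (\<lambda>t. H t - z \<cdot>\<^sub>m W t) W \<longleftrightarrow>
      (\<lambda>t. blk11 r V (W t)) \<in> Mats r r (Lp_loc 1) UNIV \<and> B \<in> Mats r r (Lp_loc 1) UNIV"
    using inv P.Meas_blocks(2) P.R_Lp P.local_index1_blocks_iff
    unfolding local_index1_def if_not_P[OF J'] Let_def schur_compl_def r_def[symmetric] lebesgue_on_UNIV_eq pencil B
      P.Ai_def[symmetric] P.S_def[symmetric] P.Wi_def[symmetric] P.R_def[symmetric]
    by blast
qed

theorem proposition5p12:
  fixes n :: nat and d :: real and J V :: "complex mat" and H W :: "real \<Rightarrow> complex mat"
  defines "n1 \<equiv> vec_space.rank n J"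
  assumes d: "0 < d"
    and J: "J \<in> carrier_mat n n" "J \<noteq> 0\<^sub>m n n" "mat_adjoint J = - J"
    and meas: "H \<in> Mats n n Meas UNIV" "W \<in> Mats n n Meas UNIV"
    and periodic: "\<And>t. H (t + d) = H t" "\<And>t. W (t + d) = W t"
    and W_pos: "AE t in lebesgue. psd (W t) \<and> Determinant.det (W t) \<noteq> 0"
    and V: "Determinant.det J = 0 \<Longrightarrow> adapted_unitary n J V"
    and H_herm: "AE t in lebesgue_on {0<..<d}. mat_adjoint (H t) = H t"
  shows
    "(Determinant.det J \<noteq> 0 \<longrightarrow>
        (H \<in> Mats n n (Lp_loc 1) UNIV \<and> W \<in> Mats n n (Lp_loc 1) UNIV \<longleftrightarrow>
          (\<exists>z0. z0 \<notin> \<real> \<and> local_index1 n J V UNIV (\<lambda>t. H t - z0 \<cdot>\<^sub>m W t) W)) \<and>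
        (H \<in> Mats n n (Lp 1) {0..d} \<and> W \<in> Mats n n (Lp 1) {0..d} \<longleftrightarrow>
          (\<exists>z0. z0 \<notin> \<real> \<and> local_index1 n J V UNIV (\<lambda>t. H t - z0 \<cdot>\<^sub>m W t) W)) \<and>
        ((\<exists>z0. z0 \<notin> \<real> \<and> local_index1 n J V UNIV (\<lambda>t. H t - z0 \<cdot>\<^sub>m W t) W) \<longrightarrow>
          (\<forall>z0. local_index1 n J V UNIV (\<lambda>t. H t - z0 \<cdot>\<^sub>m W t) W))) \<and>
     (Determinant.det J = 0 \<longrightarrow> (\<forall>z0. z0 \<notin> \<real> \<longrightarrow>
        (local_index1 n J V UNIV (\<lambda>t. H t - z0 \<cdot>\<^sub>m W t) W \<longleftrightarrow>
          (\<lambda>t. blk11 n1 V (W t)) \<in> Mats n1 n1 (Lp_loc 1) UNIV \<and>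
          (\<lambda>t. blk11 n1 V (H t) - blk12 n1 V (H t)
             * mat_inv (blk22 n1 V (H t) - z0 \<cdot>\<^sub>m blk22 n1 V (W t)) * blk21 n1 V (H t))
            \<in> Mats n1 n1 (Lp_loc 1) UNIV) \<and>
        (local_index1 n J V UNIV (\<lambda>t. H t - z0 \<cdot>\<^sub>m W t) W \<longleftrightarrow>
          (\<lambda>t. blk11 n1 V (W t)) \<in> Mats n1 n1 (Lp 1) {0..d} \<and>
          (\<lambda>t. blk11 n1 V (H t) - blk12 n1 V (H t)
             * mat_inv (blk22 n1 V (H t) - z0 \<cdot>\<^sub>m blk22 n1 V (W t)) * blk21 n1 V (H t))
            \<in> Mats n1 n1 (Lp 1) {0..d})))"
proof -
  note L1 = ae_space_Lp_loc_1
  note H_periodic = Mats_Lp_1_periodic[OF d meas(1) periodic(1)]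
  note W_periodic = Mats_Lp_1_periodic[OF d meas(2) periodic(2)]
  have herm: "AE t in lebesgue. mat_adjoint (H t) = H t"
    by (rule AE_periodic[OF d _ H_herm]) (simp only: periodic)
  have "(\<lambda>t. H t - z0 \<cdot>\<^sub>m W t) \<in> Mats n n (Lp_loc 1) UNIV \<longleftrightarrow> H \<in> Mats n n (Lp_loc 1) UNIV"
    if "W \<in> Mats n n (Lp_loc 1) UNIV" for z0
    by (rule Mats_diff_iff_left[where F = "Lp_loc 1", OF L1
          Mats_smult[where F = "Lp_loc 1", OF L1 that] Mats_UNIV_D(1)[OF meas(1)]])
  \<comment> \<open>The summand \<open>z0 \<cdot>\<^sub>m W t\<close> is integrable with
    \<open>W\<close>, so the condition does not depend on \<open>z0\<close>. This yields both the
    existential and the universal statement about \<open>z0\<close>.\<close>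
  then have nonsingular: "local_index1 n J V UNIV (\<lambda>t. H t - z0 \<cdot>\<^sub>m W t) W \<longleftrightarrow>
      H \<in> Mats n n (Lp_loc 1) UNIV \<and> W \<in> Mats n n (Lp_loc 1) UNIV"
    if "Determinant.det J \<noteq> 0" for z0
    unfolding local_index1_nonsingular_iff[OF that] by blast
  \<comment> \<open>A witness for the existential statement in the regular case, where any nonreal
    number serves.\<close>
  have nonreal: "\<exists>z0::complex. z0 \<notin> \<real>"
    by (rule exI[of _ \<i>]) (simp add: complex_is_Real_iff)
  show ?thesis
  proof (cases "Determinant.det J = 0")
    case True
    note iff = local_index1_singular_iff[OF True V[OF True] meas W_pos herm, folded n1_def]
    have blk_periodic: "blk11 n1 V (W (t + d)) = blk11 n1 V (W t)" for t
      by (simp only: periodic)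
    have "(\<lambda>t. blk11 n1 V (H t) - blk12 n1 V (H t)
             * mat_inv (blk22 n1 V (H t) - z0 \<cdot>\<^sub>m blk22 n1 V (W t)) * blk21 n1 V (H t))
            \<in> Mats n1 n1 (Lp 1) {0..d} \<longleftrightarrow>
        (\<lambda>t. blk11 n1 V (H t) - blk12 n1 V (H t)
             * mat_inv (blk22 n1 V (H t) - z0 \<cdot>\<^sub>m blk22 n1 V (W t)) * blk21 n1 V (H t))
            \<in> Mats n1 n1 (Lp_loc 1) UNIV" if "z0 \<notin> \<real>" for z0
      by (rule Mats_Lp_1_periodic[OF d iff(3)[OF that]]) (simp only: periodic)
    moreover have "(\<lambda>t. blk11 n1 V (W t)) \<in> Mats n1 n1 (Lp 1) {0..d} \<longleftrightarrow>
        (\<lambda>t. blk11 n1 V (W t)) \<in> Mats n1 n1 (Lp_loc 1) UNIV" if "z0 \<notin> \<real>" for z0 :: complex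
      by (rule Mats_Lp_1_periodic[OF d iff(2)[OF that] blk_periodic])
    ultimately show ?thesis
      using True iff(1) by (simp only: simp_thms) blast
  next
    case False
    show ?thesis
      using False nonreal unfolding H_periodic W_periodic nonsingular[OF False] by blast
  qed
qed

end
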